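(* Let $\Bbbk$ be an algebraically closed field of characteristic $p>2$, and let $A$, $s$, $C$ and $V_{\alpha,\beta,\gamma}$ be as defined in the context. For any $\alpha,\beta\in\Bbbk^{\times}$ and $\gamma\in\Bbbk$, the $A$-module $V_{\alpha,\beta,\gamma}$ is simple, with annihilator $$\operatorname{ann}_A(V_{\alpha,\beta,\gamma})=\langle C-\alpha,\ s^p-\beta,\ y^{2p}+\beta^2\gamma^p\rangle.$$ Moreover, $V_{\alpha,\beta,\gamma}\cong V_{\alpha',\beta',\gamma'}$ if and only if $\alpha'=\alpha$, $\beta'=\beta$, and $\gamma'^p=\gamma^p$.
   Context: All modules are left modules. $\Bbbk^{\times}=\Bbbk\setminus\{0\}$. $A$ (the bosonization of the super Jordan plane) is the $\Bbbk$-algebra generated by $x,y,g,g^{-1}$ with relations $x^2=0$, $ys-sy-xs=0$ where $s:=xy+yx$, $gg^{-1}=g^{-1}g=1$, $gxg^{-1}=-x$, $gyg^{-1}=-y+x$. Put $C:=(2yx-s)g^{-1}\in A$, a central element. $\langle\cdots\rangle$ denotes the two-sided ideal generated by the listed elements, and $\operatorname{ann}_A(M)$ is the annihilator of an $A$-module $M$ in $A$. For $\alpha,\beta\in\Bbbk^{\times}$ and $\gamma\in\Bbbk$, $V_{\alpha,\beta,\gamma}$ is the $2p$-dimensional $A$-module with basis $v_0,\dots,v_{p-1},w_0,\dots,w_{p-1}$ and action: $xv_i=0$ and $xw_i=v_i$ for $0\le i\le p-1$; $yv_i=w_{i+1}$ for $0\le i\le p-2$ and $yv_{p-1}=\beta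 w_0$; $yw_i=(i+1)v_i+\gamma v_{i+1}$ for $0\le i\le p-2$ and $yw_{p-1}=\beta\gamma v_0$; $gv_i=-\alpha^{-1}v_{i+1}$ for $0\le i\le p-2$ and $gv_{p-1}=-\alpha^{-1}\beta v_0$; $gw_i=\alpha^{-1}w_{i+1}$ for $0\le i\le p-2$ and $gw_{p-1}=\alpha^{-1}\beta w_0$.
   Formalization: The third generator of the annihilator is y^{2p} − β²γ^p instead of y^{2p} + β²γ^p: with the given action y^{2p} acts as the scalar β²γ^p (e.g. p = 3, α = β = γ = 1), so the printed sign is wrong whenever γ ≠ 0. *)

theory Defs
  imports "HOL-Computational_Algebra.Computational_Algebra" "HOL-Library.Poly_Mapping"
begin

section \<open>Left modules and two-sided ideals over a noncommutative ring\<close>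

definition two_sided_ideal :: "'r::ring_1 set \<Rightarrow> bool" where
  "two_sided_ideal I \<longleftrightarrow> 0 \<in> I \<and> (\<forall>a\<in>I. \<forall>b\<in>I. a + b \<in> I) \<and> (\<forall>a\<in>I. - a \<in> I) \<and>
     (\<forall>r. \<forall>a\<in>I. r * a \<in> I \<and> a * r \<in> I)"

definition ideal_gen :: "'r::ring_1 set \<Rightarrow> 'r set" where
  "ideal_gen S = \<Inter>{I. two_sided_ideal I \<and> S \<subseteq> I}"

text \<open>Modules live on a carrier set inside an abelian group type; nothing is required of the
  action outside the carrier.\<close>

locale left_module =
  fixes M :: "'m::ab_group_add set" and act :: "'r::ring_1 \<Rightarrow> 'm \<Rightarrow> 'm"
  assumes zero_mem: "0 \<in> M"
    and add_mem: "\<lbrakk>u \<in> M; v \<in> M\<rbrakk> \<Longrightarrow> u + v \<in> M"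
    and uminus_mem: "u \<in> M \<Longrightarrow> - u \<in> M"
    and act_mem: "u \<in> M \<Longrightarrow> act a u \<in> M"
    and act_add_right: "\<lbrakk>u \<in> M; v \<in> M\<rbrakk> \<Longrightarrow> act a (u + v) = act a u + act a v"
    and act_add_left: "u \<in> M \<Longrightarrow> act (a + b) u = act a u + act b u"
    and act_mult: "u \<in> M \<Longrightarrow> act (a * b) u = act a (act b u)"
    and act_one: "u \<in> M \<Longrightarrow> act 1 u = u"

definition submodule :: "'m::ab_group_add set \<Rightarrow> 'm set \<Rightarrow> ('r::ring_1 \<Rightarrow> 'm \<Rightarrow> 'm) \<Rightarrow> bool" where
  "submodule N M act \<longleftrightarrow> N \<subseteq> M \<and> left_module N act"

definition simple_module :: "'m::ab_group_add set \<Rightarrow> ('r::ring_1 \<Rightarrow> 'm \<Rightarrow> 'm) \<Rightarrow> bool" where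
  "simple_module M act \<longleftrightarrow> left_module M act \<and> M \<noteq> {0} \<and>
     (\<forall>N. submodule N M act \<longrightarrow> N = {0} \<or> N = M)"

definition annihilator :: "'m::ab_group_add set \<Rightarrow> ('r::ring_1 \<Rightarrow> 'm \<Rightarrow> 'm) \<Rightarrow> 'r set" where
  "annihilator M act = {a. \<forall>u\<in>M. act a u = 0}"

definition module_isomorphic ::
  "'m::ab_group_add set \<Rightarrow> ('r::ring_1 \<Rightarrow> 'm \<Rightarrow> 'm) \<Rightarrow>
   'n::ab_group_add set \<Rightarrow> ('r \<Rightarrow> 'n \<Rightarrow> 'n) \<Rightarrow> bool" where
  "module_isomorphic M act M' act' \<longleftrightarrow>
     (\<exists>\<phi>. bij_betw \<phi> M M' \<and> (\<forall>u\<in>M. \<forall>v\<in>M. \<phi> (u + v) = \<phi> u + \<phi> v) \<and>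
          (\<forall>a. \<forall>u\<in>M. \<phi> (act a u) = act' a (\<phi> u)))"

lemma two_sided_ideal_ideal_gen: "two_sided_ideal (ideal_gen S)"
  unfolding ideal_gen_def two_sided_ideal_def by auto

lemma ideal_gen_superset: "S \<subseteq> ideal_gen S"
  unfolding ideal_gen_def by auto

lemma ideal_gen_minimal: "two_sided_ideal I \<Longrightarrow> S \<subseteq> I \<Longrightarrow> ideal_gen S \<subseteq> I"
  unfolding ideal_gen_def by auto

lemma two_sided_idealD:
  assumes "two_sided_ideal I"
  shows "0 \<in> I" "a \<in> I \<Longrightarrow> b \<in> I \<Longrightarrow> a + b \<in> I" "a \<in> I \<Longrightarrow> - a \<in> I"
    "a \<in> I \<Longrightarrow> r * a \<in> I" "a \<in> I \<Longrightarrow> a * r \<in> I" "a \<in> I \<Longrightarrow> b \<in> I \<Longrightarrow> a - b \<in> I"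
  using assms unfolding two_sided_ideal_def
  by (auto, metis diff_conv_add_uminus)

section \<open>Linear combinations\<close>

definition vscale :: "'k::comm_ring_1 \<Rightarrow> ('b \<Rightarrow>\<^sub>0 'k) \<Rightarrow> ('b \<Rightarrow>\<^sub>0 'k)" where
  "vscale c u = Poly_Mapping.map ((*) c) u"

definition lin_ext :: "('a \<Rightarrow> ('b \<Rightarrow>\<^sub>0 'k)) \<Rightarrow> ('a \<Rightarrow>\<^sub>0 'k::comm_ring_1) \<Rightarrow> ('b \<Rightarrow>\<^sub>0 'k)" where
  "lin_ext h f = (\<Sum>a\<in>Poly_Mapping.keys f. vscale (Poly_Mapping.lookup f a) (h a))"

lemma lookup_vscale [simp]: "Poly_Mapping.lookup (vscale c u) i = c * Poly_Mapping.lookup u i"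
  unfolding vscale_def by (simp add: Poly_Mapping.map.rep_eq when_def)

lemma vscale_simps [simp]:
  "vscale 0 u = 0" "vscale c 0 = 0" "vscale 1 u = u" "vscale c (vscale d u) = vscale (c * d) u"
  "vscale c (- u) = - vscale c u" "vscale (- c) u = - vscale c u"
  by (rule poly_mapping_eqI; simp add: algebra_simps)+

lemma vscale_add: "vscale c (u + v) = vscale c u + vscale c v"
  and vscale_add_left: "vscale (c + d) u = vscale c u + vscale d u"
  and vscale_diff: "vscale c (u - v) = vscale c u - vscale c v"
  and vscale_diff_left: "vscale (c - d) u = vscale c u - vscale d u"
  by (rule poly_mapping_eqI; simp add: algebra_simps lookup_add lookup_minus)+

lemma vscale_sum: "vscale c (sum f A) = (\<Sum>a\<in>A. vscale c (f a))"
  by (induction A rule: infinite_finite_induct) (simp_all add: vscale_add)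

lemma vscale_single [simp]: "vscale c (Poly_Mapping.single a d) = Poly_Mapping.single a (c * d)"
  by (rule poly_mapping_eqI) (simp add: lookup_single when_def)

lemma keys_vscale: "Poly_Mapping.keys (vscale c u) \<subseteq> Poly_Mapping.keys u"
  by (auto simp: in_keys_iff)

lemma lin_ext_superset:
  assumes "finite A" "Poly_Mapping.keys f \<subseteq> A"
  shows "lin_ext h f = (\<Sum>a\<in>A. vscale (Poly_Mapping.lookup f a) (h a))"
  unfolding lin_ext_def
  by (rule sum.mono_neutral_left) (use assms in \<open>auto simp: in_keys_iff\<close>)

lemma lin_ext_0 [simp]: "lin_ext h 0 = 0"
  by (simp add: lin_ext_def)

lemma lin_ext_single [simp]: "lin_ext h (Poly_Mapping.single a c) = vscale c (h a)"
  by (subst lin_ext_superset[of "{a}"]) auto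

lemma lin_ext_add: "lin_ext h (f + g) = lin_ext h f + lin_ext h g"
proof -
  let ?A = "Poly_Mapping.keys f \<union> Poly_Mapping.keys g"
  have "Poly_Mapping.keys (f + g) \<subseteq> ?A" by (rule keys_add)
  then show ?thesis
    by (simp add: lin_ext_superset[of ?A] lookup_add vscale_add_left sum.distrib)
qed

lemma lin_ext_vscale: "lin_ext h (vscale c f) = vscale c (lin_ext h f)"
  using keys_vscale[of c f]
  by (simp add: lin_ext_superset[of "Poly_Mapping.keys f"] vscale_sum)

lemma lin_ext_uminus [simp]: "lin_ext h (- f) = - lin_ext h f"
  using lin_ext_vscale[of h "-1" f] by simp

lemma lin_ext_diff: "lin_ext h (f - g) = lin_ext h f - lin_ext h g"
  using lin_ext_add[of h f "- g"] by simp

lemma lin_ext_sum: "lin_ext h (sum f A) = (\<Sum>a\<in>A. lin_ext h (f a))"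
  by (induction A rule: infinite_finite_induct) (simp_all add: lin_ext_add)

lemma lin_ext_fun_add: "lin_ext (\<lambda>a. h a + h' a) f = lin_ext h f + lin_ext h' f"
  by (simp add: lin_ext_def vscale_add sum.distrib)

lemma lin_ext_fun_vscale: "lin_ext (\<lambda>a. vscale c (h a)) f = vscale c (lin_ext h f)"
  by (simp add: lin_ext_def vscale_sum mult.commute)

lemma poly_mapping_decomp:
  fixes f :: "'a \<Rightarrow>\<^sub>0 'k::comm_ring_1"
  shows "f = (\<Sum>a\<in>Poly_Mapping.keys f. Poly_Mapping.single a (Poly_Mapping.lookup f a))"
proof (rule poly_mapping_eqI)
  fix i
  show "Poly_Mapping.lookup f i = Poly_Mapping.lookup
      (\<Sum>a\<in>Poly_Mapping.keys f. Poly_Mapping.single a (Poly_Mapping.lookup f a)) i"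
    by (simp add: lookup_sum lookup_single when_def in_keys_iff)
qed

lemma poly_mapping_linear_induct [case_names zero single add]:
  fixes f :: "'a \<Rightarrow>\<^sub>0 'k::comm_ring_1"
  assumes "P 0" "\<And>a c. P (Poly_Mapping.single a c)" "\<And>f g. P f \<Longrightarrow> P g \<Longrightarrow> P (f + g)"
  shows "P f"
proof -
  have "P (\<Sum>a\<in>A. Poly_Mapping.single a (Poly_Mapping.lookup f a))" if "finite A" for A
    using that by (induction A rule: finite_induct) (simp_all add: assms)
  then show ?thesis by (subst poly_mapping_decomp) simp
qed

section \<open>The free algebra\<close>

datatype gen = X | Y | G | Ginv

text \<open>The free monoid on \<open>'a\<close>, written additively as required by the convolution product
  of \<^theory>\<open>HOL-Library.Poly_Mapping\<close>; \<open>gen fmonoid \<Rightarrow>\<^sub>0 'k\<close> is then the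
  free associative algebra on the four generators.\<close>

datatype 'a fmonoid = FMonoid (letters: "'a list")

instantiation fmonoid :: (type) monoid_add
begin
definition zero_fmonoid :: "'a fmonoid" where "0 = FMonoid []"
definition plus_fmonoid :: "'a fmonoid \<Rightarrow> 'a fmonoid \<Rightarrow> 'a fmonoid" where
  "u + v = FMonoid (letters u @ letters v)"
instance by standard (simp_all add: zero_fmonoid_def plus_fmonoid_def)
end

lemma letters_simps [simp]:
  "letters (0 :: 'a fmonoid) = []" "letters (u + v) = letters u @ letters v"
  by (simp_all add: zero_fmonoid_def plus_fmonoid_def)

type_synonym 'k free_alg = "gen fmonoid \<Rightarrow>\<^sub>0 'k"

abbreviation fgen :: "gen \<Rightarrow> 'k::field free_alg" where
  "fgen a \<equiv> Poly_Mapping.single (FMonoid [a]) 1"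

definition fs :: "'k::field free_alg" where
  "fs = fgen X * fgen Y + fgen Y * fgen X"

definition sjp_relators :: "'k::field free_alg set" where
  "sjp_relators =
     {fgen X ^ 2,
      fgen Y * fs - fs * fgen Y - fgen X * fs,
      fgen G * fgen Ginv - 1,
      fgen Ginv * fgen G - 1,
      fgen G * fgen X * fgen Ginv - (- fgen X),
      fgen G * fgen Y * fgen Ginv - (- fgen Y + fgen X)}"

text \<open>The action of the free algebra in which the generator \<open>a\<close> acts by \<open>T a\<close>.\<close>

definition free_act ::
  "(gen \<Rightarrow> ('b \<Rightarrow>\<^sub>0 'k) \<Rightarrow> ('b \<Rightarrow>\<^sub>0 'k)) \<Rightarrow> 'k::field free_alg \<Rightarrow> ('b \<Rightarrow>\<^sub>0 'k) \<Rightarrow> ('b \<Rightarrow>\<^sub>0 'k)" where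
  "free_act T f u = lin_ext (\<lambda>m. foldr T (letters m) u) f"

locale linear_family =
  fixes T :: "gen \<Rightarrow> ('b \<Rightarrow>\<^sub>0 'k::field) \<Rightarrow> ('b \<Rightarrow>\<^sub>0 'k)"
  assumes T_add: "T a (u + v) = T a u + T a v"
    and T_vscale: "T a (vscale c u) = vscale c (T a u)"
begin

lemma foldr_add: "foldr T l (u + v) = foldr T l u + foldr T l v"
  by (induction l) (simp_all add: T_add)

lemma foldr_vscale: "foldr T l (vscale c u) = vscale c (foldr T l u)"
  by (induction l) (simp_all add: T_vscale)

lemma free_act_add: "free_act T (f + g) u = free_act T f u + free_act T g u"
  by (simp add: free_act_def lin_ext_add)

lemma free_act_uminus: "free_act T (- f) u = - free_act T f u"
  by (simp add: free_act_def)

lemma free_act_diff: "free_act T (f - g) u = free_act T f u - free_act T g u"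
  by (simp add: free_act_def lin_ext_diff)

lemma free_act_0: "free_act T 0 u = 0"
  by (simp add: free_act_def)

lemma free_act_1: "free_act T 1 u = u"
  unfolding free_act_def by (simp flip: single_one)

lemma free_act_gen: "free_act T (fgen a) u = T a u"
  by (simp add: free_act_def)

lemma free_act_scalar: "free_act T (Poly_Mapping.single 0 c) u = vscale c u"
  by (simp add: free_act_def)

lemma free_act_add_right: "free_act T f (u + v) = free_act T f u + free_act T f v"
  by (simp add: free_act_def foldr_add lin_ext_fun_add)

lemma free_act_vscale_right: "free_act T f (vscale c u) = vscale c (free_act T f u)"
  by (simp add: free_act_def foldr_vscale lin_ext_fun_vscale)

lemma free_act_zero_right: "free_act T f 0 = 0"
  using free_act_vscale_right[of f 0 0] by simp

lemma free_act_mult: "free_act T (f * g) u = free_act T f (free_act T g u)"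
proof (induction f rule: poly_mapping_linear_induct)
  case (single a c)
  show ?case
  proof (induction g rule: poly_mapping_linear_induct)
    case (single b d)
    show ?case by (simp add: free_act_def mult_single foldr_vscale)
  next
    case (add g h)
    then show ?case by (simp add: algebra_simps free_act_add free_act_add_right)
  qed (simp add: free_act_0 free_act_zero_right)
next
  case (add f h)
  then show ?case by (simp add: algebra_simps free_act_add)
qed (simp add: free_act_0)

lemmas free_act_simps = free_act_add free_act_uminus free_act_diff free_act_0 free_act_1
  free_act_gen free_act_scalar free_act_mult

lemma free_act_invariant:
  assumes "0 \<in> N" "\<And>u v. u \<in> N \<Longrightarrow> v \<in> N \<Longrightarrow> u + v \<in> N" "\<And>c u. u \<in> N \<Longrightarrow> vscale c u \<in> N"
    and "\<And>a u. u \<in> N \<Longrightarrow> T a u \<in> N" and u: "u \<in> N"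
  shows "free_act T f u \<in> N"
proof (induction f rule: poly_mapping_linear_induct)
  case (single m c)
  have "foldr T l u \<in> N" for l by (induction l) (simp_all add: assms)
  then show ?case by (simp add: free_act_def assms)
qed (simp_all add: free_act_0 free_act_add assms)

lemma free_act_ideal_gen:
  assumes inv: "\<And>f u. u \<in> N \<Longrightarrow> free_act T f u \<in> N"
    and S: "\<And>f u. f \<in> S \<Longrightarrow> u \<in> N \<Longrightarrow> free_act T f u = 0"
    and f: "f \<in> ideal_gen S" and u: "u \<in> N"
  shows "free_act T f u = 0"
proof -
  let ?I = "{f. \<forall>u\<in>N. free_act T f u = 0}"
  have "two_sided_ideal ?I"
    unfolding two_sided_ideal_def by (auto simp: free_act_simps inv free_act_zero_right)
  then have "ideal_gen S \<subseteq> ?I" by (rule ideal_gen_minimal) (use S in auto)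
  then show ?thesis using f u by auto
qed

end

section \<open>The bosonization of the super Jordan plane\<close>

definition sjp_rel :: "'k::field free_alg \<Rightarrow> 'k free_alg \<Rightarrow> bool" where
  "sjp_rel f h \<longleftrightarrow> f - h \<in> ideal_gen sjp_relators"

lemma equivp_sjp_rel: "equivp sjp_rel"
proof (rule equivpI)
  note I = two_sided_idealD[OF two_sided_ideal_ideal_gen]
  show "reflp sjp_rel" by (auto intro!: reflpI simp: sjp_rel_def I(1))
  show "symp sjp_rel"
    by (rule sympI) (metis I(3) sjp_rel_def minus_diff_eq)
  show "transp sjp_rel"
    by (rule transpI) (metis (no_types) I(2) sjp_rel_def diff_add_cancel add_diff_eq)
qed

quotient_type (overloaded) 'k sjp = "'k::field free_alg" / sjp_rel
  by (rule equivp_sjp_rel)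

lemma one_notin_sjp_ideal: "(1 :: 'k::field free_alg) \<notin> ideal_gen sjp_relators"
proof
  define T :: "gen \<Rightarrow> (unit \<Rightarrow>\<^sub>0 'k) \<Rightarrow> (unit \<Rightarrow>\<^sub>0 'k)"
    where "T a u = (if a \<in> {G, Ginv} then u else 0)" for a u
  interpret linear_family T by standard (auto simp: T_def)
  assume "(1 :: 'k free_alg) \<in> ideal_gen sjp_relators"
  then have "free_act T 1 (Poly_Mapping.single () 1) = 0"
    by (rule free_act_ideal_gen[where N = UNIV, rotated 2])
      (auto simp: sjp_relators_def fs_def power2_eq_square free_act_simps T_def)
  then show False
    by (simp add: free_act_1)
      (metis lookup_single_eq lookup_zero zero_neq_one)
qed

instantiation sjp :: (field) ring_1
begin

lift_definition zero_sjp :: "'a sjp" is 0 .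
lift_definition one_sjp :: "'a sjp" is 1 .
lift_definition plus_sjp :: "'a sjp \<Rightarrow> 'a sjp \<Rightarrow> 'a sjp" is "(+)"
  unfolding sjp_rel_def
  using two_sided_idealD(2)[OF two_sided_ideal_ideal_gen] by (fastforce simp: algebra_simps)
lift_definition uminus_sjp :: "'a sjp \<Rightarrow> 'a sjp" is uminus
  unfolding sjp_rel_def
  using two_sided_idealD(3)[OF two_sided_ideal_ideal_gen] by (fastforce simp: algebra_simps)
lift_definition minus_sjp :: "'a sjp \<Rightarrow> 'a sjp \<Rightarrow> 'a sjp" is "(-)"
  unfolding sjp_rel_def
  using two_sided_idealD(6)[OF two_sided_ideal_ideal_gen] by (fastforce simp: algebra_simps)
lift_definition times_sjp :: "'a sjp \<Rightarrow> 'a sjp \<Rightarrow> 'a sjp" is "(*)"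
proof -
  fix f f' h h' :: "'a free_alg"
  assume *: "sjp_rel f f'" "sjp_rel h h'"
  note I = two_sided_idealD[OF two_sided_ideal_ideal_gen[of "sjp_relators :: 'a free_alg set"]]
  have "f * (h - h') + (f - f') * h' \<in> ideal_gen sjp_relators"
    using * unfolding sjp_rel_def by (metis I(2) I(4) I(5))
  then show "sjp_rel (f * h) (f' * h')"
    by (simp add: sjp_rel_def algebra_simps)
qed

instance
proof
  note [simp] = sjp_rel_def two_sided_idealD(1)[OF two_sided_ideal_ideal_gen]
  fix a b c :: "'a sjp"
  show "a * b * c = a * (b * c)" "a + b + c = a + (b + c)" "a + b = b + a" "0 + a = a"
    "- a + a = 0" "a - b = a + - b" "(a + b) * c = a * c + b * c" "a * (b + c) = a * b + a * c"
    "1 * a = a" "a * 1 = a"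
    by (transfer; simp add: algebra_simps)+
  show "(0 :: 'a sjp) \<noteq> 1"
  proof transfer
    show "\<not> sjp_rel (0 :: 'a free_alg) 1"
      using one_notin_sjp_ideal
        two_sided_idealD(3)[OF two_sided_ideal_ideal_gen, of "- 1 :: 'a free_alg" sjp_relators]
      by (auto simp: sjp_rel_def)
  qed
qed

end

lift_definition sjp_scalar :: "'k::field \<Rightarrow> 'k sjp" is "\<lambda>c. Poly_Mapping.single 0 c" .
lift_definition sjp_x :: "'k::field sjp" is "fgen X" .
lift_definition sjp_y :: "'k::field sjp" is "fgen Y" .
lift_definition sjp_g :: "'k::field sjp" is "fgen G" .
lift_definition sjp_ginv :: "'k::field sjp" is "fgen Ginv" .

definition sjp_s :: "'k::field sjp" where
  "sjp_s = sjp_x * sjp_y + sjp_y * sjp_x"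

definition sjp_C :: "'k::field sjp" where
  "sjp_C = (2 * sjp_y * sjp_x - sjp_s) * sjp_ginv"

lemma abs_sjp_fs: "sjp_s = abs_sjp fs"
  by (simp add: sjp_s_def fs_def sjp_x_def sjp_y_def times_sjp.abs_eq plus_sjp.abs_eq)

lemma sjp_relator_eq_0: "r \<in> sjp_relators \<Longrightarrow> abs_sjp r = 0"
  using ideal_gen_superset[of sjp_relators]
  by (auto simp: zero_sjp.abs_eq sjp.abs_eq_iff sjp_rel_def)

lemma sjp_relations:
  "(sjp_x :: 'k::field sjp) ^ 2 = 0"
  "(sjp_y :: 'k sjp) * sjp_s - sjp_s * sjp_y - sjp_x * sjp_s = 0"
  "(sjp_g :: 'k sjp) * sjp_ginv = 1" "(sjp_ginv :: 'k sjp) * sjp_g = 1"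
  "(sjp_g :: 'k sjp) * sjp_x * sjp_ginv = - sjp_x"
  "(sjp_g :: 'k sjp) * sjp_y * sjp_ginv = - sjp_y + sjp_x"
proof -
  note R = sjp_relator_eq_0[where 'a = 'k, unfolded sjp_relators_def]
  note A = abs_sjp_fs sjp_x_def sjp_y_def sjp_g_def sjp_ginv_def times_sjp.abs_eq plus_sjp.abs_eq
    minus_sjp.abs_eq uminus_sjp.abs_eq one_sjp.abs_eq power2_eq_square
  show "(sjp_x :: 'k sjp) ^ 2 = 0"
    using R[of "fgen X ^ 2"] by (simp add: A)
  show "(sjp_y :: 'k sjp) * sjp_s - sjp_s * sjp_y - sjp_x * sjp_s = 0"
    using R[of "fgen Y * fs - fs * fgen Y - fgen X * fs"] by (simp add: A)
  have "(sjp_g :: 'k sjp) * sjp_ginv - 1 = 0"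
    using R[of "fgen G * fgen Ginv - 1"] by (simp only: A) simp
  then show "(sjp_g :: 'k sjp) * sjp_ginv = 1" by simp
  have "(sjp_ginv :: 'k sjp) * sjp_g - 1 = 0"
    using R[of "fgen Ginv * fgen G - 1"] by (simp only: A) simp
  then show "(sjp_ginv :: 'k sjp) * sjp_g = 1" by simp
  have "(sjp_g :: 'k sjp) * sjp_x * sjp_ginv - (- sjp_x) = 0"
    using R[of "fgen G * fgen X * fgen Ginv - (- fgen X)"] by (simp only: A) simp
  then show "(sjp_g :: 'k sjp) * sjp_x * sjp_ginv = - sjp_x" by (simp only: right_minus_eq)
  have "(sjp_g :: 'k sjp) * sjp_y * sjp_ginv - (- sjp_y + sjp_x) = 0"
    using R[of "fgen G * fgen Y * fgen Ginv - (- fgen Y + fgen X)"] by (simp only: A) simp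
  then show "(sjp_g :: 'k sjp) * sjp_y * sjp_ginv = - sjp_y + sjp_x" by (simp only: right_minus_eq)
qed

section \<open>The modules \<open>V\<close>\<close>

text \<open>Basis symbols; only indices below the characteristic occur in the module.\<close>

datatype vidx = Vb nat | Wb nat

abbreviation vb :: "nat \<Rightarrow> vidx \<Rightarrow>\<^sub>0 'k::field" where "vb i \<equiv> Poly_Mapping.single (Vb i) 1"
abbreviation wb :: "nat \<Rightarrow> vidx \<Rightarrow>\<^sub>0 'k::field" where "wb i \<equiv> Poly_Mapping.single (Wb i) 1"

definition V_carrier :: "(vidx \<Rightarrow>\<^sub>0 'k::field) set" where
  "V_carrier = {u. Poly_Mapping.keys u \<subseteq> Vb ` {..<CHAR('k)} \<union> Wb ` {..<CHAR('k)}}"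

text \<open>The action of the generators on the basis. The clauses for \<open>Ginv\<close> are forced by those
  for \<open>G\<close> and the relations \<open>g g\<^sup>-\<^sup>1 = g\<^sup>-\<^sup>1 g = 1\<close>.

  With these signs \<open>y ^ (2 * p)\<close> acts as the scalar \<open>\<beta>\<^sup>2 * \<gamma> ^ p\<close> (for \<open>p = 3\<close>:
  \<open>y\<^sup>2 w\<^sub>0 = w\<^sub>1 + \<gamma> w\<^sub>2\<close>, \<open>y\<^sup>2 w\<^sub>1 = 2 w\<^sub>2 + \<beta> \<gamma> w\<^sub>0\<close>, \<open>y\<^sup>2 w\<^sub>2 = \<beta> \<gamma> w\<^sub>1\<close>,
  so \<open>y\<^sup>6 w\<^sub>0 = \<beta>\<^sup>2 \<gamma>\<^sup>3 w\<^sub>0\<close>). Hence the annihilator contains \<open>y ^ (2 * p) - \<beta>\<^sup>2 * \<gamma> ^ p\<close>; the variant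
  \<open>y ^ (2 * p) + \<beta>\<^sup>2 * \<gamma> ^ p\<close> does not annihilate the module unless \<open>\<gamma> = 0\<close>.\<close>

fun V_table :: "'k::field \<Rightarrow> 'k \<Rightarrow> 'k \<Rightarrow> gen \<Rightarrow> vidx \<Rightarrow> (vidx \<Rightarrow>\<^sub>0 'k)" where
  "V_table \<alpha> \<beta> \<gamma> X (Vb i) = 0"
| "V_table \<alpha> \<beta> \<gamma> X (Wb i) = vb i"
| "V_table \<alpha> \<beta> \<gamma> Y (Vb i) =
     (if i + 1 < CHAR('k) then wb (i + 1) else vscale \<beta> (wb 0))"
| "V_table \<alpha> \<beta> \<gamma> Y (Wb i) =
     (if i + 1 < CHAR('k) then vscale (of_nat (i + 1)) (vb i) + vscale \<gamma> (vb (i + 1))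
      else vscale (\<beta> * \<gamma>) (vb 0))"
| "V_table \<alpha> \<beta> \<gamma> G (Vb i) =
     (if i + 1 < CHAR('k) then vscale (- inverse \<alpha>) (vb (i + 1))
      else vscale (- inverse \<alpha> * \<beta>) (vb 0))"
| "V_table \<alpha> \<beta> \<gamma> G (Wb i) =
     (if i + 1 < CHAR('k) then vscale (inverse \<alpha>) (wb (i + 1))
      else vscale (inverse \<alpha> * \<beta>) (wb 0))"
| "V_table \<alpha> \<beta> \<gamma> Ginv (Vb i) =
     (if i > 0 then vscale (- \<alpha>) (vb (i - 1))
      else vscale (- \<alpha> * inverse \<beta>) (vb (CHAR('k) - 1)))"
| "V_table \<alpha> \<beta> \<gamma> Ginv (Wb i) =
     (if i > 0 then vscale \<alpha> (wb (i - 1))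
      else vscale (\<alpha> * inverse \<beta>) (wb (CHAR('k) - 1)))"

definition V_gen :: "'k::field \<Rightarrow> 'k \<Rightarrow> 'k \<Rightarrow> gen \<Rightarrow> (vidx \<Rightarrow>\<^sub>0 'k) \<Rightarrow> (vidx \<Rightarrow>\<^sub>0 'k)" where
  "V_gen \<alpha> \<beta> \<gamma> a = lin_ext (V_table \<alpha> \<beta> \<gamma> a)"

text \<open>An element of the quotient algebra acts through any representative in the free algebra;
  see \<open>V_act_abs\<close> for independence of the choice.\<close>

definition V_act :: "'k::field \<Rightarrow> 'k \<Rightarrow> 'k \<Rightarrow> 'k sjp \<Rightarrow> (vidx \<Rightarrow>\<^sub>0 'k) \<Rightarrow> (vidx \<Rightarrow>\<^sub>0 'k)" where
  "V_act \<alpha> \<beta> \<gamma> a u = free_act (V_gen \<alpha> \<beta> \<gamma>) (rep_sjp a) u"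

interpretation V: linear_family "V_gen \<alpha> \<beta> \<gamma>" for \<alpha> \<beta> \<gamma> :: "'k::field"
  by standard (simp_all add: V_gen_def lin_ext_add lin_ext_vscale)

lemma V_gen_simps:
  "V_gen \<alpha> \<beta> \<gamma> a (Poly_Mapping.single b c) = vscale c (V_table \<alpha> \<beta> \<gamma> a b)"
  "V_gen \<alpha> \<beta> \<gamma> a 0 = 0"
  "V_gen \<alpha> \<beta> \<gamma> a (- u) = - V_gen \<alpha> \<beta> \<gamma> a u"
  "V_gen \<alpha> \<beta> \<gamma> a (u - v) = V_gen \<alpha> \<beta> \<gamma> a u - V_gen \<alpha> \<beta> \<gamma> a v"
  by (simp_all add: V_gen_def lin_ext_diff)

lemma V_carrier_closed:
  "0 \<in> V_carrier"
  "u \<in> V_carrier \<Longrightarrow> v \<in> V_carrier \<Longrightarrow> u + v \<in> V_carrier"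
  "u \<in> V_carrier \<Longrightarrow> - u \<in> V_carrier"
  "u \<in> V_carrier \<Longrightarrow> vscale c u \<in> V_carrier"
  using keys_add[of u v] keys_vscale[of c u] keys_vscale[of "-1" u]
  by (auto simp: V_carrier_def)

lemma V_carrier_sum: "(\<And>a. a \<in> A \<Longrightarrow> f a \<in> V_carrier) \<Longrightarrow> sum f A \<in> V_carrier"
  by (induction A rule: infinite_finite_induct) (simp_all add: V_carrier_closed)

lemma V_carrier_basis:
  "i < CHAR('k) \<Longrightarrow> (vb i :: vidx \<Rightarrow>\<^sub>0 'k::field) \<in> V_carrier"
  "i < CHAR('k) \<Longrightarrow> (wb i :: vidx \<Rightarrow>\<^sub>0 'k::field) \<in> V_carrier"
  by (auto simp: V_carrier_def)

lemma V_carrier_induct [consumes 1, case_names zero vb wb add vscale]: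
  fixes u :: "vidx \<Rightarrow>\<^sub>0 'k::field"
  assumes u: "u \<in> V_carrier" and "P 0"
    and "\<And>i. i < CHAR('k) \<Longrightarrow> P (vb i)" "\<And>i. i < CHAR('k) \<Longrightarrow> P (wb i)"
    and "\<And>u v. P u \<Longrightarrow> P v \<Longrightarrow> P (u + v)" "\<And>c u. P u \<Longrightarrow> P (vscale c u)"
  shows "P u"
proof -
  have *: "P (Poly_Mapping.single a c)"
    if "a \<in> Poly_Mapping.keys u" for a c
  proof -
    have "a \<in> Vb ` {..<CHAR('k)} \<union> Wb ` {..<CHAR('k)}" using u that by (auto simp: V_carrier_def)
    then have "P (Poly_Mapping.single a 1)" using assms by auto
    then have "P (vscale c (Poly_Mapping.single a 1))" by (rule assms)
    then show ?thesis by simp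
  qed
  have "P (\<Sum>a\<in>A. Poly_Mapping.single a (Poly_Mapping.lookup u a))"
    if "A \<subseteq> Poly_Mapping.keys u" for A
    using finite_subset[OF that finite_keys] that
    by (induction A rule: finite_induct) (auto intro!: assms *)
  then show ?thesis by (subst poly_mapping_decomp) auto
qed

lemma V_gen_mem:
  fixes \<alpha> \<beta> \<gamma> :: "'k::field"
  assumes "CHAR('k) > 0" "u \<in> V_carrier"
  shows "V_gen \<alpha> \<beta> \<gamma> a u \<in> V_carrier"
proof -
  have "V_table \<alpha> \<beta> \<gamma> a b \<in> V_carrier" if "b \<in> Poly_Mapping.keys u" for b
  proof -
    have "b \<in> Vb ` {..<CHAR('k)} \<union> Wb ` {..<CHAR('k)}"
      using that assms by (auto simp: V_carrier_def)
    then show ?thesis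
      using assms(1) by (cases a) (auto intro!: V_carrier_closed V_carrier_basis simp del: vscale_single)
  qed
  then show ?thesis
    unfolding V_gen_def lin_ext_def by (intro V_carrier_sum V_carrier_closed)
qed

lemma free_act_V_mem:
  fixes \<alpha> \<beta> \<gamma> :: "'k::field"
  assumes "CHAR('k) > 0" "u \<in> V_carrier"
  shows "free_act (V_gen \<alpha> \<beta> \<gamma>) f u \<in> V_carrier"
  by (rule V.free_act_invariant) (auto intro: V_carrier_closed V_gen_mem assms)

lemma V_relators_basis:
  fixes \<alpha> \<beta> \<gamma> :: "'k::field"
  assumes p: "CHAR('k) > 2" and ab: "\<alpha> \<noteq> 0" "\<beta> \<noteq> 0" and i: "i < CHAR('k)"
  shows "\<forall>r\<in>sjp_relators. free_act (V_gen \<alpha> \<beta> \<gamma>) r (vb i) = 0" (is ?v)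
    and "\<forall>r\<in>sjp_relators. free_act (V_gen \<alpha> \<beta> \<gamma>) r (wb i) = 0" (is ?w)
proof -
  have p0: "of_nat CHAR('k) = (0 :: 'k)" by (rule of_nat_CHAR)
  consider (zero) "i = 0" "Suc (Suc i) < CHAR('k)"
    | (inner) j where "i = Suc j" "Suc (Suc i) < CHAR('k)"
    | (penult) j where "i = Suc j" "CHAR('k) = Suc (Suc i)" "of_nat j = (- 3 :: 'k)"
    | (last) j where "i = Suc j" "CHAR('k) = Suc i" "of_nat j = (- 2 :: 'k)"
  proof (cases i)
    case 0
    then show thesis using p zero by simp
  next
    case (Suc j)
    then consider "Suc (Suc i) < CHAR('k)" | "CHAR('k) = Suc (Suc i)" | "CHAR('k) = Suc i"
      using i by linarith
    then show thesis
    proof cases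
      case 1
      then show thesis using Suc inner by blast
    next
      case 2
      then have "of_nat j + 3 = (0 :: 'k)" using p0 Suc by (simp add: algebra_simps)
      then show thesis using 2 Suc penult by (simp add: eq_neg_iff_add_eq_0)
    next
      case 3
      then have "of_nat j + 2 = (0 :: 'k)" using p0 Suc by (simp add: algebra_simps)
      then show thesis using 3 Suc last by (simp add: eq_neg_iff_add_eq_0)
    qed
  qed
  note cs = this
  note gen = V.T_add V_gen_simps V.free_act_simps fs_def power2_eq_square vscale_add vscale_diff
  note eq = poly_mapping_eq_iff fun_eq_iff lookup_add lookup_minus lookup_single when_def
  show ?v using cs
    by cases (use p ab in \<open>simp add: sjp_relators_def gen; (auto simp: eq field_simps)?\<close>)+
  show ?w using cs
    by cases (use p ab in \<open>simp add: sjp_relators_def gen; (auto simp: eq field_simps)?\<close>)+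
qed

lemma V_relators:
  fixes \<alpha> \<beta> \<gamma> :: "'k::field"
  assumes p: "CHAR('k) > 2" and ab: "\<alpha> \<noteq> 0" "\<beta> \<noteq> 0" and u: "u \<in> V_carrier"
  shows "\<forall>r\<in>sjp_relators. free_act (V_gen \<alpha> \<beta> \<gamma>) r u = 0"
  using u
  by (induction u rule: V_carrier_induct)
    (simp_all add: V_relators_basis[OF p ab] V.free_act_zero_right V.free_act_add_right
      V.free_act_vscale_right)

lemma V_act_abs:
  fixes \<alpha> \<beta> \<gamma> :: "'k::field"
  assumes "CHAR('k) > 2" "\<alpha> \<noteq> 0" "\<beta> \<noteq> 0" "u \<in> V_carrier"
  shows "V_act \<alpha> \<beta> \<gamma> (abs_sjp f) u = free_act (V_gen \<alpha> \<beta> \<gamma>) f u"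
proof -
  have "sjp_rel (rep_sjp (abs_sjp f)) f"
    by (rule Quotient_rep_abs[OF Quotient_sjp]) (simp add: equivp_reflp[OF equivp_sjp_rel])
  then have "rep_sjp (abs_sjp f) - f \<in> ideal_gen sjp_relators" by (simp add: sjp_rel_def)
  then have "free_act (V_gen \<alpha> \<beta> \<gamma>) (rep_sjp (abs_sjp f) - f) u = 0"
    by (rule V.free_act_ideal_gen[where N = V_carrier, rotated 2])
      (use assms V_relators[OF assms(1-3)] in \<open>auto intro!: free_act_V_mem\<close>)
  then show ?thesis by (simp add: V_act_def V.free_act_diff)
qed

lemma left_module_V:
  fixes \<alpha> \<beta> \<gamma> :: "'k::field"
  assumes "CHAR('k) > 2" "\<alpha> \<noteq> 0" "\<beta> \<noteq> 0"
  shows "left_module V_carrier (V_act \<alpha> \<beta> \<gamma>)"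
proof
  note A = V_act_abs[OF assms, of _ \<gamma>]
  fix u v :: "vidx \<Rightarrow>\<^sub>0 'k" and a b :: "'k sjp"
  assume u: "u \<in> V_carrier"
  show mem: "V_act \<alpha> \<beta> \<gamma> a u \<in> V_carrier" for a
    using assms u by (simp add: V_act_def free_act_V_mem)
  obtain f h where f: "a = abs_sjp f" and h: "b = abs_sjp h"
    by (metis Quotient_abs_rep[OF Quotient_sjp])
  show "V_act \<alpha> \<beta> \<gamma> (a + b) u = V_act \<alpha> \<beta> \<gamma> a u + V_act \<alpha> \<beta> \<gamma> b u"
    using u by (simp add: f h plus_sjp.abs_eq A V.free_act_add)
  show "V_act \<alpha> \<beta> \<gamma> (a * b) u = V_act \<alpha> \<beta> \<gamma> a (V_act \<alpha> \<beta> \<gamma> b u)"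
    using u mem[of b] by (simp add: f h times_sjp.abs_eq A V.free_act_mult)
  show "V_act \<alpha> \<beta> \<gamma> 1 u = u"
    using u by (simp add: one_sjp.abs_eq A V.free_act_1)
  show "V_act \<alpha> \<beta> \<gamma> a (u + v) = V_act \<alpha> \<beta> \<gamma> a u + V_act \<alpha> \<beta> \<gamma> a v"
    by (simp add: V_act_def V.free_act_add_right)
qed (auto intro: V_carrier_closed)

lemma V_act_gens:
  fixes \<alpha> \<beta> \<gamma> :: "'k::field"
  assumes "CHAR('k) > 2" "\<alpha> \<noteq> 0" "\<beta> \<noteq> 0" "u \<in> V_carrier"
  shows "V_act \<alpha> \<beta> \<gamma> (sjp_scalar c) u = vscale c u"
    "V_act \<alpha> \<beta> \<gamma> sjp_x u = V_gen \<alpha> \<beta> \<gamma> X u"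
    "V_act \<alpha> \<beta> \<gamma> sjp_y u = V_gen \<alpha> \<beta> \<gamma> Y u"
    "V_act \<alpha> \<beta> \<gamma> sjp_g u = V_gen \<alpha> \<beta> \<gamma> G u"
    "V_act \<alpha> \<beta> \<gamma> sjp_ginv u = V_gen \<alpha> \<beta> \<gamma> Ginv u"
  by (simp_all add: sjp_scalar_def sjp_x_def sjp_y_def sjp_g_def sjp_ginv_def
      V_act_abs[OF assms] V.free_act_gen V.free_act_scalar)

end

(*
  Write z for the action of s. On V the powers of z carry v_0 and w_0 to the two halves of the
  basis, and y^2 acts on them as the first order operators z^2 d/dz + r z + gamma z^2 with
  r = 2 and r = 1. Iterating gives (y^2)^n z^m = sum_k C(n,k) (m+r+k)_{n-k} gamma^k z^{m+n+k},
  which for n = p is gamma^p z^{m+2p} in characteristic p.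

  Simplicity: a combination of y^2, s and s^2 acts on the v_i as d/dz, which lowers the degree of a
  nonzero vector in the span of the v_i until v_0 is reached.

  Annihilator: modulo the ideal J every element is a combination of s^i x^e y^n with e < 2 and
  n < 2p, because g is congruent to alpha^{-1} (2 y x - s) and (2 y x - s)^2 = s^2. If such a
  combination kills V, multiplication by x on either side isolates groups of terms of the form
  sum_b c_b (y^2)^b with c_b a polynomial in s, up to a factor x. Since [y^2, s^{p-1}] = - s^p is a
  nonzero scalar modulo J, commutators with s^{p-1} differentiate with respect to y^2, so each c_b x
  kills V and hence c_b lies in J.

  Isomorphism: the central elements C, s^p and y^{2p} recover alpha, beta and gamma^p, and
  gamma^p determines gamma.
*)

theory Submission
  imports Defs
begin

section \<open>The super Jordan plane\<close>

text \<open>The defining relations without \<open>g\<close>, for elements of any ring, so that the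
  commutation rules follow by plain ring computation.\<close>

locale super_jordan_plane =
  fixes x y s :: "'r::ring_1"
  assumes x_x: "x * x = 0" and x_y: "x * y + y * x = s" and y_s': "y * s - s * y - x * s = 0"
begin

lemma x_x_left: "x * (x * a) = 0"
  by (simp add: x_x flip: mult.assoc)

text \<open>Both sides equal \<open>x * y * x\<close>, because \<open>x * x = 0\<close>.\<close>

lemma x_s: "x * s = s * x"
  by (simp add: algebra_simps x_x x_x_left flip: x_y)

lemma y_s: "y * s = s * y + s * x"
  using y_s' by (simp add: x_s algebra_simps)

lemma y_x: "y * x = s - x * y"
  by (simp flip: x_y)

lemma x_s_power: "x * s ^ n = s ^ n * x"
  by (metis power_commuting_commutes x_s)

text \<open>Commutation with \<open>y\<close> is a derivation sending \<open>s\<close> to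
  \<open>s * x\<close>, and \<open>x\<close> commutes with \<open>s\<close>.\<close>

lemma y_s_power: "y * s ^ n = s ^ n * y + of_nat n * s ^ n * x"
proof (induction n)
  case (Suc n)
  have "y * s ^ Suc n = (y * s) * s ^ n" by (simp add: mult.assoc)
  also have "\<dots> = s * (y * s ^ n) + s * (x * s ^ n)"
    by (simp add: y_s algebra_simps)
  also have "\<dots> = s ^ Suc n * y + of_nat (Suc n) * s ^ Suc n * x"
    unfolding Suc.IH x_s_power by (simp add: algebra_simps mult_of_nat_commute)
  finally show ?case .
qed simp

text \<open>Two applications of \<open>y_s_power\<close>: the terms linear in \<open>x\<close>
  combine to \<open>x * y + y * x = s\<close>, and the quadratic one vanishes.\<close>

lemma y2_s_power: "y\<^sup>2 * s ^ n = s ^ n * y\<^sup>2 + of_nat n * s ^ Suc n"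
proof -
  have c: "y * (of_nat n * a) = of_nat n * (y * a)" for a
    by (metis mult.assoc mult_of_nat_commute)
  have "y\<^sup>2 * s ^ n = y * (y * s ^ n)" by (simp add: power2_eq_square mult.assoc)
  also have "\<dots> = (y * s ^ n) * y + of_nat n * ((y * s ^ n) * x)"
    by (subst y_s_power) (simp add: distrib_left mult.assoc c)
  also have "\<dots> = s ^ n * (y * y) + of_nat n * (s ^ n * (x * y + y * x))"
    unfolding y_s_power by (simp add: distrib_left distrib_right mult.assoc x_x)
  also have "\<dots> = s ^ n * y\<^sup>2 + of_nat n * s ^ Suc n"
    by (simp add: power_commutes x_y power2_eq_square)
  finally show ?thesis .
qed

lemma y2_x: "y\<^sup>2 * x = x * (y\<^sup>2 + s)"
proof -
  have "y\<^sup>2 * x = y * (s - x * y)" by (simp add: power2_eq_square mult.assoc flip: y_x)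
  also have "\<dots> = y * s - (s - x * y) * y"
    by (metis mult.assoc right_diff_distrib y_x)
  also have "\<dots> = x * (y\<^sup>2 + s)"
    by (simp add: y_s power2_eq_square distrib_left left_diff_distrib mult.assoc x_s)
  finally show ?thesis .
qed

lemma y2_power_x: "(y\<^sup>2) ^ b * x = x * (y\<^sup>2 + s) ^ b"
proof (induction b)
  case (Suc b)
  have "(y\<^sup>2) ^ Suc b * x = y\<^sup>2 * ((y\<^sup>2) ^ b * x)" by (simp add: mult.assoc)
  also have "\<dots> = (y\<^sup>2 * x) * (y\<^sup>2 + s) ^ b" by (simp only: Suc.IH mult.assoc)
  also have "\<dots> = x * (y\<^sup>2 + s) ^ Suc b" by (simp only: y2_x mult.assoc power_Suc)
  finally show ?case .
qed simp

lemma x_y2_power_x: "x * ((y\<^sup>2) ^ b * x) = 0"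
  by (simp add: y2_power_x x_x_left)

lemma x_y_x: "x * (y * x) = s * x"
  by (simp add: algebra_simps x_x flip: x_y)

text \<open>By \<open>y2_power_x\<close> the inner product starts with \<open>x\<close>, and
  \<open>x * y * x = s * x\<close>. Together with \<open>x_y2_power_x\<close>, right multiplication
  by \<open>x\<close> thus tells odd from even powers of \<open>y\<close> after an
  \<open>x\<close>.\<close>

lemma x_y_y2_power_x: "x * (y * ((y\<^sup>2) ^ b * x)) = s * ((y\<^sup>2) ^ b * x)"
proof -
  have "x * (y * ((y\<^sup>2) ^ b * x)) = x * (y * x) * (y\<^sup>2 + s) ^ b"
    by (simp only: y2_power_x mult.assoc)
  then show ?thesis by (simp only: y2_power_x mult.assoc x_y_x)
qed

text \<open>\<open>y * x * y * x\<close> and \<open>y * x * s\<close> both equal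
  \<open>s * y * x\<close>, so the mixed terms cancel. Hence \<open>2 * y * x - s\<close> is
  invertible wherever \<open>s\<close> is, which later yields an expression for the inverse of
  \<open>g\<close>.\<close>

lemma t_square: "(2 * y * x - s) * (2 * y * x - s) = s\<^sup>2"
proof -
  have 1: "y * (x * s) = s * (y * x)"
  proof -
    have "y * (x * s) = (y * s) * x" by (simp add: x_s mult.assoc)
    then show ?thesis by (simp add: y_s algebra_simps x_x)
  qed
  have 2: "y * (x * (y * x)) = s * (y * x)"
    using 1 by (simp add: x_y_x x_s)
  show ?thesis
    by (simp add: power2_eq_square mult_2 distrib_left distrib_right left_diff_distrib
        right_diff_distrib mult.assoc 1 2)
qed

lemma s_CHAR_y:
  assumes "of_nat p = (0 :: 'r)"
  shows "s ^ p * y = y * s ^ p"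
  using assms by (simp add: y_s_power)

text \<open>Commutation with \<open>s ^ (p - 1)\<close> is a derivation; \<open>y\<^sup>2\<close>
  contributes \<open>(p - 1) * s ^ p = - s ^ p\<close>, which commutes with
  \<open>y\<^sup>2\<close>.\<close>

lemma y2_power_s_power_pred:
  assumes "of_nat p = (0 :: 'r)" "p > 0"
  shows "(y\<^sup>2) ^ b * s ^ (p - 1) = s ^ (p - 1) * (y\<^sup>2) ^ b - of_nat b * s ^ p * (y\<^sup>2) ^ (b - 1)"
proof (induction b)
  case (Suc b)
  let ?Y = "y\<^sup>2"
  have c: "?Y * s ^ p = s ^ p * ?Y"
    using s_CHAR_y[OF assms(1)] by (metis mult.assoc power2_eq_square)
  have p1: "of_nat (p - 1) = (- 1 :: 'r)"
    using assms by (cases p) (simp_all add: add_eq_0_iff)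
  have u: "?Y * s ^ (p - 1) = s ^ (p - 1) * ?Y - s ^ p"
    using y2_s_power[of "p - 1"] assms(2) by (simp add: p1 del: One_nat_def of_nat_diff of_nat_Suc)
  have "?Y ^ Suc b * s ^ (p - 1) = ?Y * (?Y ^ b * s ^ (p - 1))" by (simp add: mult.assoc)
  also have "\<dots> = (?Y * s ^ (p - 1)) * ?Y ^ b - of_nat b * (?Y * s ^ p) * ?Y ^ (b - 1)"
    unfolding Suc.IH by (simp add: algebra_simps mult_of_nat_commute)
  also have "\<dots> = s ^ (p - 1) * ?Y ^ Suc b - s ^ p * ?Y ^ b - of_nat b * s ^ p * (?Y * ?Y ^ (b - 1))"
    unfolding u c by (simp add: algebra_simps)
  \<comment> \<open>For \<open>b = 0\<close> the truncated exponent \<open>b - 1\<close> is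
    harmless, since the factor \<open>of_nat b\<close> is zero.\<close>
  also have "of_nat b * s ^ p * (?Y * ?Y ^ (b - 1)) = of_nat b * s ^ p * ?Y ^ b"
    by (cases b) simp_all
  finally show ?case by (simp add: algebra_simps)
qed simp

end

section \<open>Scalars and words in the algebra A\<close>

lemma sjp_scalar_simps:
  "sjp_scalar 0 = 0" "sjp_scalar 1 = 1"
  "sjp_scalar (c + d) = sjp_scalar c + sjp_scalar d"
  "sjp_scalar (c * d) = sjp_scalar c * sjp_scalar d"
  by (simp_all add: sjp_scalar_def zero_sjp.abs_eq one_sjp.abs_eq plus_sjp.abs_eq
      times_sjp.abs_eq mult_single flip: single_add)

lemma sjp_scalar_of_nat: "sjp_scalar (of_nat n) = of_nat n"
  by (induction n) (simp_all add: sjp_scalar_simps)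

lemma abs_sjp_cases: obtains f where "a = abs_sjp f"
  by (metis Quotient_abs_rep[OF Quotient_sjp])

text \<open>Scalars sit on the empty word, so they are central already in the free algebra.\<close>

lemma sjp_scalar_commute: "sjp_scalar c * a = a * sjp_scalar c"
proof -
  have "Poly_Mapping.single 0 c * f = f * Poly_Mapping.single 0 c" for f :: "'a free_alg"
    by (induction f rule: poly_mapping_linear_induct)
      (simp_all add: mult_single algebra_simps)
  then show ?thesis
    by (cases a rule: abs_sjp_cases) (simp add: sjp_scalar_def times_sjp.abs_eq)
qed

lemma of_nat_CHAR_sjp: "of_nat CHAR('k) = (0 :: 'k::field sjp)"
  by (metis of_nat_CHAR sjp_scalar_of_nat sjp_scalar_simps(1))

text \<open>A word is built by multiplying generators from the left, starting from the empty word,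
  which carries the coefficient.\<close>

lemma sjp_left_induct [case_names scalar add x y g ginv]:
  fixes a :: "'k::field sjp"
  assumes "\<And>c. P (sjp_scalar c)" "\<And>a b. P a \<Longrightarrow> P b \<Longrightarrow> P (a + b)"
    and "\<And>a. P a \<Longrightarrow> P (sjp_x * a)" "\<And>a. P a \<Longrightarrow> P (sjp_y * a)"
    and "\<And>a. P a \<Longrightarrow> P (sjp_g * a)" "\<And>a. P a \<Longrightarrow> P (sjp_ginv * a)"
  shows "P a"
proof -
  have "P (abs_sjp f)" for f
  proof (induction f rule: poly_mapping_linear_induct)
    case zero
    show ?case using assms(1)[of 0] by (simp add: sjp_scalar_simps zero_sjp.abs_eq)
  next
    case (single m c)
    have "P (abs_sjp (Poly_Mapping.single (FMonoid l) c))" for l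
    proof (induction l)
      case Nil
      show ?case using assms(1)[of c] by (simp add: sjp_scalar_def zero_fmonoid_def)
    next
      case (Cons k l)
      have "abs_sjp (Poly_Mapping.single (FMonoid (k # l)) c)
          = abs_sjp (fgen k) * abs_sjp (Poly_Mapping.single (FMonoid l) c)"
        by (simp add: times_sjp.abs_eq mult_single plus_fmonoid_def)
      then show ?case
        using assms(3-6)[OF Cons]
        by (cases k) (simp_all add: sjp_x_def sjp_y_def sjp_g_def sjp_ginv_def)
    qed
    then show ?case by (cases m) simp
  next
    case (add f g)
    then show ?case using assms(2) by (simp flip: plus_sjp.abs_eq)
  qed
  then show ?thesis by (cases a rule: abs_sjp_cases) simp
qed

interpretation sjp: super_jordan_plane sjp_x sjp_y "sjp_s :: 'k::field sjp"
  using sjp_relations(1,2)[where 'k = 'k]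
  by unfold_locales (simp_all add: power2_eq_square sjp_s_def)

section \<open>The action on V\<close>

context left_module
begin

lemma act_zero_left: "u \<in> M \<Longrightarrow> act 0 u = 0"
  using act_add_left[of u 0 0] by simp

lemma act_uminus_left: "u \<in> M \<Longrightarrow> act (- a) u = - act a u"
  using act_add_left[of u a "- a"] by (simp add: act_zero_left minus_unique)

lemma act_diff_left: "u \<in> M \<Longrightarrow> act (a - b) u = act a u - act b u"
  using act_add_left[of u a "- b"] by (simp add: act_uminus_left)

lemma act_zero_right: "act a 0 = 0"
  using act_add_right[of 0 0 a] by (simp add: zero_mem)

lemma act_power: "u \<in> M \<Longrightarrow> act (a ^ n) u = (act a ^^ n) u"
  by (induction n) (simp_all add: act_one act_mult)

lemma two_sided_ideal_annihilator: "two_sided_ideal (annihilator M act)"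
  unfolding two_sided_ideal_def annihilator_def
  by (auto simp: act_zero_left act_zero_right act_add_left act_uminus_left act_mult act_mem)

end

text \<open>Recurrence for the coefficients in \<open>funpow_shift_operator\<close>, with
  \<open>a = m + r\<close>: one more application of the operator either multiplies by a number or
  raises the power of \<gamma> by one.\<close>

lemma binomial_pochhammer_rec:
  fixes a n k :: nat
  assumes "k \<le> n"
  shows "(Suc n choose Suc k) * pochhammer (a + Suc k) (n - k) =
    (n choose Suc k) * pochhammer (a + Suc k) (n - Suc k) * (a + n + Suc k) +
    (n choose k) * pochhammer (a + k) (n - k)"
\<comment> \<open>For \<open>k = n\<close> the difference \<open>n - Suc k\<close> truncates, but
  then \<open>n choose Suc k\<close> is 0.\<close>
proof (cases "k = n")
  case False
  then obtain j where j: "n = k + Suc j"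
    using assms by (metis add_Suc_right le_neq_implies_less less_imp_Suc_add)
  let ?Q = "pochhammer (a + Suc k) j"
  have b: "Suc k * (n choose Suc k) = Suc j * (n choose k)"
    using binomial_absorption[of k n] binomial_absorb_comp[of n k] j by simp
  have 1: "pochhammer (a + Suc k) (n - k) = ?Q * (a + n)"
    using j by (simp add: pochhammer_Suc)
  have 2: "pochhammer (a + k) (n - k) = (a + k) * ?Q"
    using j by (simp add: pochhammer_rec)
  have "((n choose k) + (n choose Suc k)) * (?Q * (a + n))
      = (n choose k) * ((a + k) * ?Q) + (n choose Suc k) * (?Q * (a + n)) + (Suc j * (n choose k)) * ?Q"
    using j by (simp add: algebra_simps)
  also have "\<dots> = (n choose Suc k) * ?Q * (a + n + Suc k) + (n choose k) * ((a + k) * ?Q)"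
    unfolding b[symmetric] by (simp add: algebra_simps)
  moreover have "n - Suc k = j" using j by simp
  ultimately show ?thesis by (simp only: binomial_Suc_Suc 1 2)
qed simp

text \<open>The hypothesis on \<open>T\<close> models \<open>z\<^sup>2 d/dz + r z + \<gamma> z\<^sup>2\<close> acting on the powers of \<open>z\<close>.\<close>

lemma funpow_shift_operator:
  fixes T :: "('b \<Rightarrow>\<^sub>0 'k::comm_ring_1) \<Rightarrow> ('b \<Rightarrow>\<^sub>0 'k)" and E :: "nat \<Rightarrow> ('b \<Rightarrow>\<^sub>0 'k)"
  assumes add: "\<And>u v. T (u + v) = T u + T v" and scale: "\<And>c u. T (vscale c u) = vscale c (T u)"
    and T: "\<And>m. T (E m) = vscale (of_nat (m + r)) (E (Suc m)) + vscale \<gamma> (E (Suc (Suc m)))"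
  shows "(T ^^ n) (E m) =
    (\<Sum>k\<le>n. vscale (of_nat ((n choose k) * pochhammer (m + r + k) (n - k)) * \<gamma> ^ k) (E (m + n + k)))"
proof (induction n)
  case (Suc n)
  define c :: "nat \<Rightarrow> nat \<Rightarrow> 'k" where "c n k = of_nat ((n choose k) * pochhammer (m + r + k) (n - k))" for n k
  have T_sum: "T (sum f A) = (\<Sum>i\<in>A. T (f i))" for f and A :: "nat set"
    using scale[of 0 0] by (induction A rule: infinite_finite_induct) (simp_all add: add)
  have rec0: "c (Suc n) 0 = c n 0 * of_nat (m + r + n)"
    by (simp add: c_def pochhammer_Suc)
  have rec: "c (Suc n) (Suc k) = c n (Suc k) * of_nat (m + r + n + Suc k) + c n k"
    if "k \<le> n" for k
    unfolding c_def by (simp only: binomial_pochhammer_rec[OF that, of "m + r"] diff_Suc_Suc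
        flip: of_nat_mult of_nat_add)
  have IH: "(T ^^ n) (E m) = (\<Sum>k\<le>n. vscale (c n k * \<gamma> ^ k) (E (m + n + k)))"
    using Suc.IH by (simp only: c_def)
  let ?f = "\<lambda>k. E (m + Suc n + k)"
  have "(T ^^ Suc n) (E m) = (\<Sum>k\<le>n. vscale (c n k * of_nat (m + r + n + k) * \<gamma> ^ k) (?f k))
      + (\<Sum>k\<le>n. vscale (c n k * \<gamma> ^ Suc k) (?f (Suc k)))"
    by (simp add: IH T_sum scale T vscale_add sum.distrib ac_simps)
  \<comment> \<open>The extra term \<open>k = Suc n\<close> is zero because
    \<open>n choose Suc n\<close> is; the range now allows the index shift that aligns both
    sums.\<close>
  also have "(\<Sum>k\<le>n. vscale (c n k * of_nat (m + r + n + k) * \<gamma> ^ k) (?f k))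
      = (\<Sum>k\<le>Suc n. vscale (c n k * of_nat (m + r + n + k) * \<gamma> ^ k) (?f k))"
    by (simp add: c_def binomial_eq_0)
  also have "\<dots> = vscale (c (Suc n) 0) (?f 0)
      + (\<Sum>k\<le>n. vscale (c n (Suc k) * of_nat (m + r + n + Suc k) * \<gamma> ^ Suc k) (?f (Suc k)))"
    by (subst sum.atMost_Suc_shift) (simp add: rec0)
  also have "\<dots> + (\<Sum>k\<le>n. vscale (c n k * \<gamma> ^ Suc k) (?f (Suc k)))
      = vscale (c (Suc n) 0) (?f 0)
      + (\<Sum>k\<le>n. vscale (c (Suc n) (Suc k) * \<gamma> ^ Suc k) (?f (Suc k)))"
    by (simp add: rec distrib_right vscale_add_left sum.distrib add.assoc del: of_nat_add of_nat_Suc power_Suc)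
  also have "\<dots> = (\<Sum>k\<le>Suc n. vscale (c (Suc n) k * \<gamma> ^ k) (?f k))"
    by (subst sum.atMost_Suc_shift) simp
  finally show ?case by (simp only: c_def)
qed simp

text \<open>A product of p consecutive integers is divisible by \<open>fact p\<close>, hence by
  p.\<close>

lemma of_nat_pochhammer_CHAR:
  assumes "CHAR('k) > 0"
  shows "of_nat (pochhammer a CHAR('k)) = (0 :: 'k::comm_ring_1)"
proof -
  have "int (fact CHAR('k)) dvd int (pochhammer a CHAR('k))"
    by (metis fact_dvd_pochhammer of_nat_fact pochhammer_of_nat)
  moreover have "CHAR('k) dvd fact CHAR('k)" using assms by (simp add: dvd_fact)
  ultimately show ?thesis
    by (metis dvd_trans int_dvd_int_iff of_nat_eq_0_iff_char_dvd)
qed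

lemma of_nat_mod_CHAR: "of_nat (n mod CHAR('k)) = (of_nat n :: 'k::comm_ring_1)"
proof -
  have "of_nat n = (of_nat (CHAR('k) * (n div CHAR('k)) + n mod CHAR('k)) :: 'k)" by simp
  then show ?thesis by (simp only: of_nat_add of_nat_mult of_nat_CHAR) simp
qed

section \<open>Generators and central elements acting on V\<close>

locale sjp_V =
  fixes \<alpha> \<beta> \<gamma> :: "'k::field"
  assumes p: "CHAR('k) > 2" and \<alpha>: "\<alpha> \<noteq> 0" and \<beta>: "\<beta> \<noteq> 0"
begin

sublocale left_module V_carrier "V_act \<alpha> \<beta> \<gamma>"
  using p \<alpha> \<beta> by (rule left_module_V)

abbreviation act :: "'k sjp \<Rightarrow> (vidx \<Rightarrow>\<^sub>0 'k) \<Rightarrow> (vidx \<Rightarrow>\<^sub>0 'k)" where "act \<equiv> V_act \<alpha> \<beta> \<gamma>"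

text \<open>The bases extended to all indices by \<open>v\<^sub>i\<^sub>+\<^sub>p = \<beta> v\<^sub>i\<close> and \<open>w\<^sub>i\<^sub>+\<^sub>p = \<beta> w\<^sub>i\<close>,
  so that \<open>s\<close> is the index shift.\<close>

definition vv :: "nat \<Rightarrow> vidx \<Rightarrow>\<^sub>0 'k" where
  "vv n = Poly_Mapping.single (Vb (n mod CHAR('k))) (\<beta> ^ (n div CHAR('k)))"

definition ww :: "nat \<Rightarrow> vidx \<Rightarrow>\<^sub>0 'k" where
  "ww n = Poly_Mapping.single (Wb (n mod CHAR('k))) (\<beta> ^ (n div CHAR('k)))"

lemma vv_mem [simp]: "vv n \<in> V_carrier" and ww_mem [simp]: "ww n \<in> V_carrier"
  using p by (auto simp: V_carrier_def vv_def ww_def split: if_splits)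

lemma vscale_mem [simp]: "u \<in> V_carrier \<Longrightarrow> vscale c u \<in> V_carrier"
  by (rule V_carrier_closed)

lemma vv_eq: "i < CHAR('k) \<Longrightarrow> vv i = vb i" and ww_eq: "i < CHAR('k) \<Longrightarrow> ww i = wb i"
  by (simp_all add: vv_def ww_def)

lemma vv_add_CHAR: "vv (n + CHAR('k)) = vscale \<beta> (vv n)"
  and ww_add_CHAR: "ww (n + CHAR('k)) = vscale \<beta> (ww n)"
  using p by (simp_all add: vv_def ww_def)

lemma act_vscale: "act a (vscale c u) = vscale c (act a u)"
  by (simp add: V_act_def V.free_act_vscale_right)

lemma act_add: "act a (u + v) = act a u + act a v"
  by (simp add: V_act_def V.free_act_add_right)

lemma act_sum: "act a (sum f A) = (\<Sum>i\<in>A. act a (f i))"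
  by (induction A rule: infinite_finite_induct) (simp_all add: act_zero_right act_add)

lemma act_scalar: "u \<in> V_carrier \<Longrightarrow> act (sjp_scalar c) u = vscale c u"
  using V_act_gens(1)[OF p \<alpha> \<beta>] .

lemma act_of_nat: "u \<in> V_carrier \<Longrightarrow> act (of_nat n) u = vscale (of_nat n) u"
  by (metis act_scalar sjp_scalar_of_nat)

lemma act_numeral: "u \<in> V_carrier \<Longrightarrow> act (numeral n) u = vscale (numeral n) u"
  using act_of_nat[of u "numeral n"] by simp

text \<open>In the wrap-around case the index is -1 in the field, so the coefficient
  \<open>of_nat (Suc n)\<close> in the action of \<open>y\<close> vanishes. The special table
  entries at p - 1 thereby obey the general formula.\<close>

lemma Suc_mod_CHAR_cases:
  obtains "Suc (n mod CHAR('k)) < CHAR('k)" "Suc n mod CHAR('k) = Suc (n mod CHAR('k))"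
      "Suc n div CHAR('k) = n div CHAR('k)"
    | "\<not> Suc (n mod CHAR('k)) < CHAR('k)" "n mod CHAR('k) = CHAR('k) - 1" "of_nat n = (- 1 :: 'k)" "Suc n mod CHAR('k) = 0"
      "Suc n div CHAR('k) = Suc (n div CHAR('k))"
proof (cases "Suc (n mod CHAR('k)) = CHAR('k)")
  case True
  then have "of_nat (Suc n) = (0 :: 'k)"
    using of_nat_mod_CHAR[of "Suc n", where 'k = 'k] by (simp add: mod_Suc)
  then have "of_nat n = (- 1 :: 'k)" by (simp add: eq_neg_iff_add_eq_0 add.commute)
  moreover have "n mod CHAR('k) = CHAR('k) - 1" using True by simp
  ultimately show thesis using that(2) True by (simp add: mod_Suc div_Suc)
next
  case False
  moreover have "n mod CHAR('k) < CHAR('k)" using p by simp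
  ultimately show thesis using that(1) by (simp add: mod_Suc div_Suc)
qed

lemma act_x: "act sjp_x (vv n) = 0" "act sjp_x (ww n) = vv n"
  by (simp_all add: V_act_gens(2)[OF p \<alpha> \<beta>]) (simp_all add: vv_def ww_def V_gen_simps)

lemma act_y:
  "act sjp_y (vv n) = ww (Suc n)"
  "act sjp_y (ww n) = vscale (of_nat (Suc n)) (vv n) + vscale \<gamma> (vv (Suc n))"
  unfolding V_act_gens(3)[OF p \<alpha> \<beta> vv_mem] V_act_gens(3)[OF p \<alpha> \<beta> ww_mem]
  unfolding vv_def ww_def
  by (cases n rule: Suc_mod_CHAR_cases;
      simp add: V_gen_simps vscale_add of_nat_mod_CHAR mult.commute mult.left_commute mult.assoc)+

text \<open>Successor indices keep the lowered index a natural number; by periodicity they still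
  reach every basis vector.\<close>

lemma act_ginv:
  "act sjp_ginv (vv (Suc n)) = vscale (- \<alpha>) (vv n)"
  "act sjp_ginv (ww (Suc n)) = vscale \<alpha> (ww n)"
proof -
  have cancel: "\<alpha> * inverse \<beta> * (\<beta> * c) = \<alpha> * c" for c
    using \<beta> by (simp add: field_simps)
  note gens = V_act_gens(5)[OF p \<alpha> \<beta> vv_mem] V_act_gens(5)[OF p \<alpha> \<beta> ww_mem]
  show "act sjp_ginv (vv (Suc n)) = vscale (- \<alpha>) (vv n)"
    unfolding gens unfolding vv_def
    by (cases n rule: Suc_mod_CHAR_cases) (simp_all add: V_gen_simps cancel mult.commute)
  show "act sjp_ginv (ww (Suc n)) = vscale \<alpha> (ww n)"
    unfolding gens unfolding ww_def
    by (cases n rule: Suc_mod_CHAR_cases) (simp_all add: V_gen_simps cancel mult.commute)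
qed

text \<open>Only \<open>x * y\<close> contributes on \<open>vv\<close>, and only
  \<open>y * x\<close> on \<open>ww\<close>.\<close>

lemma act_s: "act sjp_s (vv n) = vv (Suc n)" "act sjp_s (ww n) = ww (Suc n)"
  by (simp_all add: sjp_s_def act_add_left act_mult act_x act_y act_add act_vscale act_zero_right)

lemma act_s_power: "act (sjp_s ^ m) (vv n) = vv (n + m)" "act (sjp_s ^ m) (ww n) = ww (n + m)"
  by (induction m) (simp_all add: act_one act_mult act_s)

text \<open>The operator of \<open>funpow_shift_operator\<close>, with r = 2 on \<open>vv\<close>
  and r = 1 on \<open>ww\<close>: on \<open>vv\<close> the index is raised before the coefficient is
  produced, on \<open>ww\<close> after.\<close>

lemma act_y2:
  "act (sjp_y\<^sup>2) (vv m) = vscale (of_nat (m + 2)) (vv (Suc m)) + vscale \<gamma> (vv (Suc (Suc m)))"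
  "act (sjp_y\<^sup>2) (ww m) = vscale (of_nat (m + 1)) (ww (Suc m)) + vscale \<gamma> (ww (Suc (Suc m)))"
  by (simp_all add: power2_eq_square act_mult act_y act_add act_vscale add.commute)

text \<open>\<open>2 * y * x - s\<close> shifts \<open>vv\<close> with sign -1 and \<open>ww\<close>
  with sign +1; these signs cancel those of \<open>ginv\<close>.\<close>

lemma act_C: "act sjp_C (vv (Suc n)) = vscale \<alpha> (vv (Suc n))"
  "act sjp_C (ww (Suc n)) = vscale \<alpha> (ww (Suc n))"
proof -
  have two: "vscale 2 u = u + u" for u :: "vidx \<Rightarrow>\<^sub>0 'k"
    using vscale_add_left[of 1 1 u] by simp
  have "act (2 * sjp_y * sjp_x - sjp_s) (vv n) = - vv (Suc n)"
    "act (2 * sjp_y * sjp_x - sjp_s) (ww n) = ww (Suc n)"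
    by (simp_all add: act_diff_left act_mult act_numeral act_x act_y act_s act_zero_right two act_mem)
  then show "act sjp_C (vv (Suc n)) = vscale \<alpha> (vv (Suc n))"
    "act sjp_C (ww (Suc n)) = vscale \<alpha> (ww (Suc n))"
    by (simp_all only: sjp_C_def act_mult act_ginv act_vscale vv_mem ww_mem) simp_all
qed

lemma act_y_CHAR:
  "act (sjp_y ^ (2 * CHAR('k))) (vv m) = vscale (\<beta>\<^sup>2 * \<gamma> ^ CHAR('k)) (vv m)"
  "act (sjp_y ^ (2 * CHAR('k))) (ww m) = vscale (\<beta>\<^sup>2 * \<gamma> ^ CHAR('k)) (ww m)"
proof -
  let ?p = "CHAR('k)"
  have prime: "prime ?p" using p prime_CHAR_semidom[where 'a = 'k] by simp
  have *: "act (sjp_y ^ (2 * ?p)) (E m) = vscale (\<beta>\<^sup>2 * \<gamma> ^ ?p) (E m)"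
    if E: "\<And>m. act (sjp_y\<^sup>2) (E m) = vscale (of_nat (m + r)) (E (Suc m)) + vscale \<gamma> (E (Suc (Suc m)))"
      and mem: "E m \<in> V_carrier" and per: "\<And>m. E (m + ?p) = vscale \<beta> (E m)" for E r
  proof -
    \<comment> \<open>For \<open>k = 0\<close> the Pochhammer factor vanishes in characteristic p,
      for \<open>0 < k < p\<close> the binomial coefficient.\<close>
    have 0: "(of_nat ((?p choose k) * pochhammer (m + r + k) (?p - k)) :: 'k) = 0" if "k < ?p" for k
    proof (cases "k = 0")
      case True
      then show ?thesis using p by (simp add: of_nat_pochhammer_CHAR)
    next
      case False
      then have "?p dvd (?p choose k)" using that prime p by (intro dvd_choose_prime) auto
      then show ?thesis by (simp add: of_nat_eq_0_iff_char_dvd flip: of_nat_mult)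
    qed
    have "act (sjp_y ^ (2 * ?p)) (E m) = (act (sjp_y\<^sup>2) ^^ ?p) (E m)"
      by (simp add: power_mult act_power mem)
    also have "\<dots> = (\<Sum>k\<le>?p. vscale (of_nat ((?p choose k) * pochhammer (m + r + k) (?p - k)) * \<gamma> ^ k)
        (E (m + ?p + k)))"
      by (rule funpow_shift_operator[OF act_add act_vscale E])
    \<comment> \<open>Only \<open>k = p\<close> survives; its index \<open>m + p + p\<close> is two
      periods away and gives the factor \<open>\<beta>\<^sup>2\<close>.\<close>
    also have "\<dots> = (\<Sum>k\<in>{?p}. vscale (\<gamma> ^ k) (E (m + ?p + k)))"
      by (rule sum.mono_neutral_cong_right) (auto simp: 0 simp del: of_nat_mult)
    finally show ?thesis by (simp add: per power2_eq_square mult.commute mult.left_commute)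
  qed
  show "act (sjp_y ^ (2 * ?p)) (vv m) = vscale (\<beta>\<^sup>2 * \<gamma> ^ ?p) (vv m)"
    by (rule *[where E = vv and r = 2, OF act_y2(1) vv_mem vv_add_CHAR])
  show "act (sjp_y ^ (2 * ?p)) (ww m) = vscale (\<beta>\<^sup>2 * \<gamma> ^ ?p) (ww m)"
    by (rule *[where E = ww and r = 1, OF act_y2(2) ww_mem ww_add_CHAR])
qed

lemma carrier_induct [consumes 1, case_names zero vv ww add vscale]:
  assumes u: "u \<in> V_carrier" and "P 0" and vv: "\<And>i. P (vv (Suc i))" and ww: "\<And>i. P (ww (Suc i))"
    and "\<And>u v. P u \<Longrightarrow> P v \<Longrightarrow> P (u + v)" and scale: "\<And>c u. P u \<Longrightarrow> P (vscale c u)"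
  shows "P u"
  using u
proof (induction u rule: V_carrier_induct)
  case (vb i)
  \<comment> \<open>One full period replaces \<open>i\<close> by the successor \<open>i + p\<close>
    at the cost of a factor \<beta>.\<close>
  have "vb i = vscale (inverse \<beta>) (vv (Suc (i + (CHAR('k) - 1))))"
    using vb p \<beta> vv_add_CHAR[of i] by (simp add: vv_eq)
  then show ?case using vv scale by metis
next
  case (wb i)
  have "wb i = vscale (inverse \<beta>) (ww (Suc (i + (CHAR('k) - 1))))"
    using wb p \<beta> ww_add_CHAR[of i] by (simp add: ww_eq)
  then show ?case using ww scale by metis
qed (use assms in auto)

lemma mem_annihilatorI:
  assumes "\<And>i. act a (vv (Suc i)) = 0" "\<And>i. act a (ww (Suc i)) = 0"
  shows "a \<in> annihilator V_carrier act"
proof -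
  have "act a u = 0" if "u \<in> V_carrier" for u
    using that by (induction u rule: carrier_induct)
      (simp_all add: assms act_zero_right act_add act_vscale)
  then show ?thesis by (simp add: annihilator_def)
qed

text \<open>The third generator has a minus sign because \<open>y ^ (2 * p)\<close> acts as the
  scalar \<open>\<beta>\<^sup>2 * \<gamma> ^ p\<close>, see \<open>act_y_CHAR\<close>.\<close>

definition J :: "'k sjp set" where
  "J = ideal_gen {sjp_C - sjp_scalar \<alpha>, sjp_s ^ CHAR('k) - sjp_scalar \<beta>,
    sjp_y ^ (2 * CHAR('k)) - sjp_scalar (\<beta>\<^sup>2 * \<gamma> ^ CHAR('k))}"

lemma J_subset_annihilator: "J \<subseteq> annihilator V_carrier act"
  unfolding J_def
proof (rule ideal_gen_minimal[OF two_sided_ideal_annihilator])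
  show "{sjp_C - sjp_scalar \<alpha>, sjp_s ^ CHAR('k) - sjp_scalar \<beta>,
    sjp_y ^ (2 * CHAR('k)) - sjp_scalar (\<beta>\<^sup>2 * \<gamma> ^ CHAR('k))} \<subseteq> annihilator V_carrier act"
    by (auto intro!: mem_annihilatorI
        simp: act_diff_left act_scalar act_C act_s_power act_y_CHAR vv_add_CHAR ww_add_CHAR
        simp flip: add_Suc)
qed

section \<open>Coordinates and simplicity of V\<close>

lemma lookup_sum_vv:
  "i < CHAR('k) \<Longrightarrow> Poly_Mapping.lookup (\<Sum>i<CHAR('k). vscale (c i) (vv i)) (Vb i) = c i"
  by (simp add: vv_eq lookup_sum lookup_single when_def cong: sum.cong_simp)

lemma carrier_decomp:
  assumes "u \<in> V_carrier"
  shows "u = (\<Sum>i<CHAR('k). vscale (Poly_Mapping.lookup u (Vb i)) (vv i)) +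
    (\<Sum>i<CHAR('k). vscale (Poly_Mapping.lookup u (Wb i)) (ww i))"
proof (rule poly_mapping_eqI)
  fix j
  have "Poly_Mapping.lookup u j = 0" if "j \<notin> Vb ` {..<CHAR('k)} \<union> Wb ` {..<CHAR('k)}"
    using assms that by (auto simp: V_carrier_def in_keys_iff)
  then show "Poly_Mapping.lookup u j = Poly_Mapping.lookup ((\<Sum>i<CHAR('k). vscale (Poly_Mapping.lookup u (Vb i)) (vv i)) +
    (\<Sum>i<CHAR('k). vscale (Poly_Mapping.lookup u (Wb i)) (ww i))) j"
    by (cases j) (auto simp: vv_eq ww_eq lookup_add lookup_sum lookup_single when_def image_iff cong: sum.cong_simp)
qed

text \<open>With \<open>v\<^sub>i = s\<^sup>i v\<^sub>0\<close>, the element \<open>s\<^sup>p\<^sup>-\<^sup>2 (y\<^sup>2 - 2 s - \<gamma> s\<^sup>2)\<close> acts on the \<open>v\<^sub>i\<close> as \<open>\<beta> d/ds\<close>.\<close>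

lemma act_derivation:
  "act (sjp_s ^ (CHAR('k) - 2) * (sjp_y\<^sup>2 - 2 * sjp_s - sjp_scalar \<gamma> * sjp_s\<^sup>2)) (vv i) =
    vscale (of_nat i * \<beta>) (vv (i - 1))"
proof -
  have "act (sjp_y\<^sup>2 - 2 * sjp_s - sjp_scalar \<gamma> * sjp_s\<^sup>2) (vv i) = vscale (of_nat i) (vv (Suc i))"
    by (simp add: act_diff_left act_mult act_numeral act_scalar act_y2 act_s act_s_power
        vscale_add_left)
  then have "act (sjp_s ^ (CHAR('k) - 2) * (sjp_y\<^sup>2 - 2 * sjp_s - sjp_scalar \<gamma> * sjp_s\<^sup>2)) (vv i)
      = vscale (of_nat i) (vv (Suc i + (CHAR('k) - 2)))"
    by (simp only: act_mult vv_mem act_vscale act_s_power)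
  also have "\<dots> = vscale (of_nat i * \<beta>) (vv (i - 1))"
  proof (cases i)
    case (Suc j)
    \<comment> \<open>The exponent p - 2 makes the total shift p - 1: a full period minus one
      step.\<close>
    then have "Suc i + (CHAR('k) - 2) = j + CHAR('k)" using p by simp
    then show ?thesis using Suc by (simp only: vv_add_CHAR) simp
  qed simp
  finally show ?thesis .
qed

context
  fixes N assumes N: "submodule N V_carrier act"
begin

text \<open>Submodules are defined by the ring action alone; closure under field scalars holds
  because scalars are elements of the algebra.\<close>

lemma N_closed: "0 \<in> N" "u \<in> N \<Longrightarrow> v \<in> N \<Longrightarrow> u + v \<in> N" "u \<in> N \<Longrightarrow> act a u \<in> N"
  "u \<in> N \<Longrightarrow> vscale c u \<in> N" "u \<in> N \<Longrightarrow> u \<in> V_carrier"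
proof -
  interpret N: left_module N act using N by (simp add: submodule_def)
  show "0 \<in> N" "u \<in> N \<Longrightarrow> v \<in> N \<Longrightarrow> u + v \<in> N" and m: "u \<in> N \<Longrightarrow> act a u \<in> N" for a
    by (simp_all add: N.zero_mem N.add_mem N.act_mem)
  show "u \<in> N \<Longrightarrow> u \<in> V_carrier" using N by (auto simp: submodule_def)
  then show "u \<in> N \<Longrightarrow> vscale c u \<in> N" using m[of "sjp_scalar c"] by (simp add: act_scalar)
qed

text \<open>The derivation lowers the degree by one and multiplies the leading coefficient by n
  times \<beta>, which is nonzero for 0 < n < p.\<close>

lemma submodule_vv_0:
  assumes "(\<Sum>i\<le>n. vscale (c i) (vv i)) \<in> N" "c n \<noteq> 0" "n < CHAR('k)"
  shows "vv 0 \<in> N"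
  using assms
proof (induction n arbitrary: c)
  case 0
  then show ?case using N_closed(4)[of "vscale (c 0) (vv 0)" "inverse (c 0)"] by simp
next
  case (Suc n)
  have "(\<Sum>i\<le>Suc n. vscale (c i * (of_nat i * \<beta>)) (vv (i - 1))) \<in> N"
    using N_closed(3)[OF Suc.prems(1), of
        "sjp_s ^ (CHAR('k) - 2) * (sjp_y\<^sup>2 - 2 * sjp_s - sjp_scalar \<gamma> * sjp_s\<^sup>2)"]
    by (simp only: act_sum act_vscale act_derivation vscale_simps)
  then have "(\<Sum>i\<le>n. vscale (c (Suc i) * (of_nat (Suc i) * \<beta>)) (vv i)) \<in> N"
    by (subst (asm) sum.atMost_Suc_shift) simp
  moreover have "(of_nat (Suc n) :: 'k) \<noteq> 0"
    using Suc.prems(3) by (metis of_nat_eq_0_iff_char_dvd dvd_imp_le not_le zero_less_Suc)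
  ultimately show ?case
    using Suc.prems(2,3) \<beta> by (intro Suc.IH[of "\<lambda>i. c (Suc i) * (of_nat (Suc i) * \<beta>)"]) auto
qed

lemma submodule_vv_0':
  assumes "(\<Sum>i<CHAR('k). vscale (c i) (vv i)) \<in> N" "j < CHAR('k)" "c j \<noteq> 0"
  shows "vv 0 \<in> N"
proof -
  define n where "n = Max {i. i < CHAR('k) \<and> c i \<noteq> 0}"
  have "n \<in> {i. i < CHAR('k) \<and> c i \<noteq> 0}"
    unfolding n_def by (rule Max_in) (use assms in auto)
  then have n: "n < CHAR('k)" "c n \<noteq> 0" by auto
  have "c i = 0" if "i < CHAR('k)" "n < i" for i
  proof (rule ccontr)
    assume "c i \<noteq> 0"
    then have "i \<le> n" unfolding n_def by (intro Max_ge) (use that in auto)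
    then show False using that by simp
  qed
  then have "(\<Sum>i<CHAR('k). vscale (c i) (vv i)) = (\<Sum>i\<le>n. vscale (c i) (vv i))"
    using n by (intro sum.mono_neutral_right) auto
  then show ?thesis using submodule_vv_0 n assms(1) by metis
qed

text \<open>If \<open>vv 0\<close> lies in \<open>N\<close>, then \<open>s\<close> and
  \<open>y\<close> produce the whole module. Otherwise \<open>submodule_vv_0'\<close> applied to
  \<open>x\<close> times \<open>u\<close> kills the \<open>ww\<close> coordinates of any
  \<open>u\<close> in \<open>N\<close>, and applied to \<open>u\<close> itself kills the
  rest.\<close>

lemma submodule_cases: "N = {0} \<or> N = V_carrier"
proof (rule disjCI)
  assume "N \<noteq> V_carrier"
  have "vv 0 \<notin> N"
  proof
    assume "vv 0 \<in> N"
    then have vv: "vv n \<in> N" for n using N_closed(3)[of "vv 0" "sjp_s ^ n"] by (simp add: act_s_power)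
    have ww: "ww (Suc n) \<in> N" for n using N_closed(3)[OF vv, of sjp_y n] by (simp add: act_y)
    have "u \<in> N" if "u \<in> V_carrier" for u
      using that by (induction u rule: carrier_induct) (simp_all add: N_closed vv ww)
    with \<open>N \<noteq> V_carrier\<close> N_closed(5) show False by auto
  qed
  have "u = 0" if "u \<in> N" for u
  proof -
    let ?a = "\<lambda>i. Poly_Mapping.lookup u (Vb i)" and ?b = "\<lambda>i. Poly_Mapping.lookup u (Wb i)"
    have u: "u = (\<Sum>i<CHAR('k). vscale (?a i) (vv i)) + (\<Sum>i<CHAR('k). vscale (?b i) (ww i))"
      by (rule carrier_decomp) (use that N_closed in auto)
    have "act sjp_x u = (\<Sum>i<CHAR('k). vscale (?b i) (vv i))"
      by (subst u) (simp add: act_add act_sum act_vscale act_x)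
    then have b: "\<forall>i<CHAR('k). ?b i = 0"
      using submodule_vv_0' \<open>vv 0 \<notin> N\<close> N_closed(3)[OF that] by metis
    then have u': "u = (\<Sum>i<CHAR('k). vscale (?a i) (vv i))" using u by simp
    then have "\<forall>i<CHAR('k). ?a i = 0"
      using submodule_vv_0' \<open>vv 0 \<notin> N\<close> that by metis
    then show "u = 0" using u' by simp
  qed
  then show "N = {0}" using N_closed(1) by auto
qed

end

lemma simple_V: "simple_module V_carrier act"
  unfolding simple_module_def
proof (intro conjI allI impI)
  have "vv 0 \<noteq> 0" by (simp add: vv_def) (metis lookup_single_eq lookup_zero zero_neq_one)
  then show "V_carrier \<noteq> ({0} :: (vidx \<Rightarrow>\<^sub>0 'k) set)" using vv_mem[of 0] by force
qed (auto intro: left_module_axioms dest: submodule_cases)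

end

section \<open>Isomorphism classes\<close>

lemma power_CHAR_inj:
  fixes a b :: "'k::field"
  assumes p: "CHAR('k) > 2" and eq: "a ^ CHAR('k) = b ^ CHAR('k)"
  shows "a = b"
proof -
  have prime: "prime CHAR('k)" using p prime_CHAR_semidom[where 'a = 'k] by simp
  \<comment> \<open>Additivity of Frobenius gives \<open>(a - b) ^ p = 0\<close>.\<close>
  have "(a - b + b) ^ CHAR('k) = (a - b) ^ CHAR('k) + b ^ CHAR('k)"
    by (rule freshmans_dream[OF prime refl])
  then show ?thesis using eq p by simp
qed

lemma V_isomorphic_iff:
  fixes \<alpha> \<beta> \<gamma> \<alpha>' \<beta>' \<gamma>' :: "'k::field"
  assumes p: "CHAR('k) > 2" and nz: "\<alpha> \<noteq> 0" "\<beta> \<noteq> 0" "\<alpha>' \<noteq> 0" "\<beta>' \<noteq> 0"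
  shows "module_isomorphic V_carrier (V_act \<alpha> \<beta> \<gamma>) V_carrier (V_act \<alpha>' \<beta>' \<gamma>') \<longleftrightarrow>
    \<alpha>' = \<alpha> \<and> \<beta>' = \<beta> \<and> \<gamma>' ^ CHAR('k) = \<gamma> ^ CHAR('k)"
proof
  interpret A: sjp_V \<alpha> \<beta> \<gamma> using assms by unfold_locales
  interpret B: sjp_V \<alpha>' \<beta>' \<gamma>' using assms by unfold_locales
  assume "module_isomorphic V_carrier (V_act \<alpha> \<beta> \<gamma>) V_carrier (V_act \<alpha>' \<beta>' \<gamma>')"
  then obtain \<phi> where bij: "bij_betw \<phi> V_carrier V_carrier"
    and eqv: "\<And>a u. u \<in> V_carrier \<Longrightarrow> \<phi> (V_act \<alpha> \<beta> \<gamma> a u) = V_act \<alpha>' \<beta>' \<gamma>' a (\<phi> u)"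
    unfolding module_isomorphic_def by auto
  \<comment> \<open>An algebra element acting as scalars on both modules must act by the same one;
    this is applied to \<open>sjp_C\<close>, \<open>s ^ p\<close> and
    \<open>y ^ (2 * p)\<close>.\<close>
  have scalar: "c = d" if "a - sjp_scalar c \<in> A.J" "a - sjp_scalar d \<in> B.J" for a c d
  proof -
    obtain v where v: "v \<in> V_carrier" "\<phi> v = B.vv 0"
      using bij B.vv_mem unfolding bij_betw_def by (metis imageE)
    have "A.act a v = vscale c v"
      using that(1) A.J_subset_annihilator v(1)
      by (auto simp: annihilator_def A.act_diff_left A.act_scalar)
    \<comment> \<open>The map is only additive and equivariant, so the scalar must be moved across
      it as an algebra element.\<close>
    then have "A.act (sjp_scalar c) v = A.act a v" using v(1) by (simp add: A.act_scalar)
    then have "B.act (sjp_scalar c) (B.vv 0) = B.act a (B.vv 0)" using eqv v by metis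
    also have "\<dots> = vscale d (B.vv 0)"
      using that(2) B.J_subset_annihilator B.vv_mem[of 0]
      by (auto simp: annihilator_def B.act_diff_left B.act_scalar)
    finally have "vscale c (B.vv 0) = vscale d (B.vv 0)" by (simp add: B.act_scalar)
    then have "Poly_Mapping.lookup (vscale c (B.vv 0)) (Vb 0) = Poly_Mapping.lookup (vscale d (B.vv 0)) (Vb 0)"
      by simp
    then show "c = d" by (simp add: B.vv_def)
  qed
  have \<alpha>: "\<alpha> = \<alpha>'" by (rule scalar) (auto simp: A.J_def B.J_def intro: ideal_gen_superset[THEN subsetD])
  have \<beta>: "\<beta> = \<beta>'" by (rule scalar) (auto simp: A.J_def B.J_def intro: ideal_gen_superset[THEN subsetD])
  have "\<beta>\<^sup>2 * \<gamma> ^ CHAR('k) = \<beta>'\<^sup>2 * \<gamma>' ^ CHAR('k)"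
    by (rule scalar) (auto simp: A.J_def B.J_def intro: ideal_gen_superset[THEN subsetD])
  with \<alpha> \<beta> nz show "\<alpha>' = \<alpha> \<and> \<beta>' = \<beta> \<and> \<gamma>' ^ CHAR('k) = \<gamma> ^ CHAR('k)" by simp
next
  assume "\<alpha>' = \<alpha> \<and> \<beta>' = \<beta> \<and> \<gamma>' ^ CHAR('k) = \<gamma> ^ CHAR('k)"
  \<comment> \<open>Injectivity of Frobenius makes the two modules equal, so the identity is an
    isomorphism.\<close>
  then have "\<alpha>' = \<alpha>" "\<beta>' = \<beta>" "\<gamma>' = \<gamma>" using power_CHAR_inj[OF p] by auto
  then show "module_isomorphic V_carrier (V_act \<alpha> \<beta> \<gamma>) V_carrier (V_act \<alpha>' \<beta>' \<gamma>')"
    unfolding module_isomorphic_def by (intro exI[of _ id]) auto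
qed

section \<open>The annihilator\<close>

lemma sjp_scalar_minus_one: "sjp_scalar (- 1) = - 1"
  using sjp_scalar_simps(3)[of "- 1" 1] by (simp add: sjp_scalar_simps eq_neg_iff_add_eq_0)

lemma sjp_scalar_left_commute: "a * (sjp_scalar c * b) = sjp_scalar c * (a * b)"
  by (simp add: sjp_scalar_commute[of c a, symmetric] flip: mult.assoc)

lemma two_sided_ideal_scalar_cancel:
  assumes I: "two_sided_ideal I" and "c \<noteq> 0" "sjp_scalar c * a \<in> I"
  shows "a \<in> I"
proof -
  have "sjp_scalar (inverse c) * (sjp_scalar c * a) = sjp_scalar (inverse c * c) * a"
    by (simp add: sjp_scalar_simps mult.assoc)
  then show ?thesis
    using two_sided_idealD(4)[OF I assms(3), of "sjp_scalar (inverse c)"] assms(2)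
    by (simp add: sjp_scalar_simps)
qed

lemma x_s_power_left: "sjp_x * (sjp_s ^ n * a) = sjp_s ^ n * (sjp_x * a)"
  by (simp add: sjp.x_s_power flip: mult.assoc)

text \<open>The polynomials in \<open>s\<close>, generated inductively so that additive properties
  need checking only on monomials.\<close>

inductive_set s_span :: "'k::field sjp set" where
  monomial: "sjp_scalar c * sjp_s ^ n \<in> s_span"
| add: "a \<in> s_span \<Longrightarrow> b \<in> s_span \<Longrightarrow> a + b \<in> s_span"

lemma s_span_0: "0 \<in> s_span"
  using s_span.monomial[of 0 0] by (simp add: sjp_scalar_simps)

lemma s_span_commute:
  assumes "q \<in> s_span"
  shows "q * sjp_x = sjp_x * q" "q * sjp_s ^ m = sjp_s ^ m * q"
proof -
  show "q * sjp_x = sjp_x * q" using assms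
  proof induction
    case (monomial c n)
    show ?case by (simp add: mult.assoc sjp_scalar_left_commute[of sjp_x] sjp.x_s_power)
  qed (simp add: algebra_simps)
  show "q * sjp_s ^ m = sjp_s ^ m * q" using assms
  proof induction
    case (monomial c n)
    show ?case
      by (simp add: mult.assoc sjp_scalar_left_commute[of "_ ^ _"] add.commute flip: power_add)
  qed (simp add: algebra_simps)
qed

lemma s_span_mult_s: "q \<in> s_span \<Longrightarrow> q * sjp_s \<in> s_span"
proof (induction rule: s_span.induct)
  case (monomial c n)
  then show ?case using s_span.monomial[of c "Suc n"] by (simp add: mult.assoc power_Suc2 del: power_Suc)
qed (simp add: distrib_right s_span.add)

text \<open>Exponents are left unbounded so that the set is stable under left multiplication by
  \<open>x\<close> and \<open>y\<close>; they are reduced later, modulo \<open>J\<close>.\<close>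

inductive_set xy_span :: "'k::field sjp set" where
  y_monomial: "sjp_scalar c * sjp_s ^ n * sjp_y ^ b \<in> xy_span"
| x_monomial: "sjp_scalar c * sjp_s ^ n * (sjp_x * sjp_y ^ b) \<in> xy_span"
| add: "a \<in> xy_span \<Longrightarrow> b \<in> xy_span \<Longrightarrow> a + b \<in> xy_span"

lemma xy_span_scalar: "sjp_scalar c \<in> xy_span"
  using xy_span.y_monomial[of c 0 0] by simp

lemma xy_span_mult_scalar: "a \<in> xy_span \<Longrightarrow> sjp_scalar d * a \<in> xy_span"
proof (induction rule: xy_span.induct)
  case (y_monomial c n b)
  show ?case
    using xy_span.y_monomial[of "d * c" n b] by (simp add: sjp_scalar_simps mult.assoc)
next
  case (x_monomial c n b)
  show ?case
    using xy_span.x_monomial[of "d * c" n b] by (simp add: sjp_scalar_simps mult.assoc)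
qed (simp add: distrib_left xy_span.add)

lemma xy_span_diff: "a \<in> xy_span \<Longrightarrow> b \<in> xy_span \<Longrightarrow> a - b \<in> xy_span"
  using xy_span.add[of a "sjp_scalar (- 1) * b"] xy_span_mult_scalar[of b "- 1"]
  by (simp add: sjp_scalar_minus_one)

lemma xy_span_mult_x: "a \<in> xy_span \<Longrightarrow> sjp_x * a \<in> xy_span"
proof (induction rule: xy_span.induct)
  case (y_monomial c n b)
  have "sjp_x * (sjp_scalar c * sjp_s ^ n * sjp_y ^ b) = sjp_scalar c * sjp_s ^ n * (sjp_x * sjp_y ^ b)"
    by (simp add: mult.assoc sjp_scalar_left_commute[of sjp_x] x_s_power_left)
  then show ?case by (simp add: xy_span.x_monomial)
next
  case (x_monomial c n b)
  have "sjp_x * (sjp_scalar c * sjp_s ^ n * (sjp_x * sjp_y ^ b))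
      = sjp_scalar c * sjp_s ^ n * (sjp_x * (sjp_x * sjp_y ^ b))"
    by (simp add: mult.assoc sjp_scalar_left_commute[of sjp_x] x_s_power_left)
  then show ?case using xy_span_scalar[of 0] by (simp add: sjp.x_x_left sjp_scalar_simps)
qed (simp add: distrib_left xy_span.add)

lemma xy_span_mult_y: "a \<in> xy_span \<Longrightarrow> sjp_y * a \<in> xy_span"
proof (induction rule: xy_span.induct)
  case (y_monomial c n b)
  have "sjp_y * (sjp_scalar c * sjp_s ^ n * sjp_y ^ b) = sjp_scalar c * (sjp_y * sjp_s ^ n) * sjp_y ^ b"
    by (simp add: mult.assoc sjp_scalar_left_commute[of sjp_y])
  also have "\<dots> = sjp_scalar c * sjp_s ^ n * sjp_y ^ Suc b
      + sjp_scalar (c * of_nat n) * sjp_s ^ n * (sjp_x * sjp_y ^ b)"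
    by (simp add: sjp.y_s_power sjp_scalar_simps sjp_scalar_of_nat distrib_left distrib_right mult.assoc)
  finally show ?case by (simp add: xy_span.intros del: power_Suc)
next
  case (x_monomial c n b)
  have "sjp_y * (sjp_scalar c * sjp_s ^ n * (sjp_x * sjp_y ^ b))
      = sjp_scalar c * (sjp_y * sjp_s ^ n) * (sjp_x * sjp_y ^ b)"
    by (simp add: mult.assoc sjp_scalar_left_commute[of sjp_y])
  \<comment> \<open>The commutator term of \<open>y\<close> with \<open>s ^ n\<close> contains
    \<open>x\<close> and dies against the following \<open>x\<close>.\<close>
  also have "\<dots> = sjp_scalar c * sjp_s ^ n * ((sjp_y * sjp_x) * sjp_y ^ b)"
    by (simp add: sjp.y_s_power distrib_left distrib_right mult.assoc sjp.x_x_left)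
  also have "\<dots> = sjp_scalar c * sjp_s ^ Suc n * sjp_y ^ b
      - sjp_scalar c * sjp_s ^ n * (sjp_x * sjp_y ^ Suc b)"
    by (simp add: sjp.y_x left_diff_distrib right_diff_distrib power_Suc2 mult.assoc del: power_Suc)
      (simp add: power_commutes flip: mult.assoc)
  finally show ?case by (simp add: xy_span.intros xy_span_diff del: power_Suc)
qed (simp add: distrib_left xy_span.add)

lemma xy_span_mult_t: "a \<in> xy_span \<Longrightarrow> (2 * sjp_y * sjp_x - sjp_s) * a \<in> xy_span"
proof -
  assume a: "a \<in> xy_span"
  \<comment> \<open>\<open>2 * y * x - s\<close> is the commutator
    \<open>y * x - x * y\<close>.\<close>
  have "(2 * sjp_y * sjp_x - sjp_s) * a = sjp_y * (sjp_x * a) - sjp_x * (sjp_y * a)"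
    by (simp add: sjp_s_def mult_2 algebra_simps)
  then show ?thesis by (simp add: a xy_span_diff xy_span_mult_x xy_span_mult_y)
qed

lemma xy_span_mult_s_power: "a \<in> xy_span \<Longrightarrow> sjp_s ^ n * a \<in> xy_span"
proof (induction n)
  case (Suc n)
  have "sjp_s * b \<in> xy_span" if "b \<in> xy_span" for b :: "'a sjp"
    using that by (simp add: sjp_s_def distrib_right mult.assoc xy_span.add xy_span_mult_x xy_span_mult_y)
  then show ?case using Suc by (simp add: mult.assoc)
qed simp

section \<open>Reduction modulo J\<close>

context sjp_V
begin

lemma two_sided_ideal_J: "two_sided_ideal J"
  unfolding J_def by (rule two_sided_ideal_ideal_gen)

lemmas J_ideal = two_sided_idealD[OF two_sided_ideal_J]

lemma J_gens: "sjp_C - sjp_scalar \<alpha> \<in> J" "sjp_s ^ CHAR('k) - sjp_scalar \<beta> \<in> J"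
  "sjp_y ^ (2 * CHAR('k)) - sjp_scalar (\<beta>\<^sup>2 * \<gamma> ^ CHAR('k)) \<in> J"
  unfolding J_def by (auto intro!: subsetD[OF ideal_gen_superset])

lemma J_trans: "a - b \<in> J \<Longrightarrow> b - c \<in> J \<Longrightarrow> a - c \<in> J"
  using J_ideal(2)[of "a - b" "b - c"] by simp

lemma J_power: "a - sjp_scalar c \<in> J \<Longrightarrow> a ^ n - sjp_scalar (c ^ n) \<in> J"
proof (induction n)
  case (Suc n)
  have "a ^ Suc n - sjp_scalar (c ^ Suc n)
      = a * (a ^ n - sjp_scalar (c ^ n)) + (a - sjp_scalar c) * sjp_scalar (c ^ n)"
    by (simp add: sjp_scalar_simps algebra_simps)
  then show ?case using Suc J_ideal by simp
qed (simp add: sjp_scalar_simps J_ideal)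

lemmas J_scalar_cancel = two_sided_ideal_scalar_cancel[OF two_sided_ideal_J]

text \<open>Induction step of \<open>xy_span_mod_J\<close> for a generator \<open>r\<close>: it may
  be replaced by a congruent \<open>r'\<close> that preserves \<open>xy_span\<close>.\<close>

lemma xy_span_cong_left_mult:
  assumes "r - r' \<in> J" "\<And>m. m \<in> xy_span \<Longrightarrow> r' * m \<in> xy_span" "\<exists>m\<in>xy_span. a - m \<in> J"
  shows "\<exists>m\<in>xy_span. r * a - m \<in> J"
proof -
  obtain m where m: "m \<in> xy_span" "a - m \<in> J" using assms(3) by blast
  have "r * a - r' * m = (r - r') * a + r' * (a - m)" by (simp add: algebra_simps)
  then have "r * a - r' * m \<in> J" using assms(1) m(2) J_ideal by simp
  then show ?thesis using assms(2) m(1) by blast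
qed

lemma xy_span_mod_J: "\<exists>m\<in>xy_span. a - m \<in> J"
proof (induction a rule: sjp_left_induct)
  case (scalar c)
  show ?case using xy_span_scalar[of c] J_ideal(1) by (intro bexI[of _ "sjp_scalar c"]) auto
next
  case (add a b)
  then obtain m n where "m \<in> xy_span" "n \<in> xy_span" "a - m \<in> J" "b - n \<in> J" by blast
  moreover have "a + b - (m + n) = (a - m) + (b - n)" by simp
  ultimately show ?case using J_ideal(2) xy_span.add by metis
next
  case (x a)
  show ?case by (rule xy_span_cong_left_mult[OF _ xy_span_mult_x x]) (simp_all add: J_ideal)
next
  case (y a)
  show ?case by (rule xy_span_cong_left_mult[OF _ xy_span_mult_y y]) (simp_all add: J_ideal)
next
  case (g a)
  let ?t = "2 * sjp_y * sjp_x - sjp_s :: 'k sjp"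
  \<comment> \<open>\<open>sjp_C * sjp_g\<close> is \<open>?t\<close>, so \<open>g\<close> is
    congruent to the inverse of \<alpha> times \<open>?t\<close>.\<close>
  have "(sjp_C - sjp_scalar \<alpha>) * sjp_g = ?t - sjp_scalar \<alpha> * sjp_g"
    by (simp add: sjp_C_def left_diff_distrib[of _ "sjp_scalar \<alpha>"] mult.assoc sjp_relations)
  then have "- (?t - sjp_scalar \<alpha> * sjp_g) \<in> J" using J_gens(1) J_ideal(3,5) by metis
  moreover have "sjp_scalar \<alpha> * (sjp_g - sjp_scalar (inverse \<alpha>) * ?t) = - (?t - sjp_scalar \<alpha> * sjp_g)"
    using \<alpha> by (simp add: right_diff_distrib[of "sjp_scalar \<alpha>"] flip: mult.assoc sjp_scalar_simps(4))
      (simp add: sjp_scalar_simps)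
  ultimately have "sjp_g - sjp_scalar (inverse \<alpha>) * ?t \<in> J" using J_scalar_cancel \<alpha> by metis
  then show ?case
    by (rule xy_span_cong_left_mult[OF _ _ g]) (simp add: mult.assoc[of "sjp_scalar _"] xy_span_mult_t xy_span_mult_scalar)
next
  case (ginv a)
  let ?t = "2 * sjp_y * sjp_x - sjp_s :: 'k sjp" and ?p = "CHAR('k)"
  \<comment> \<open>Evaluating \<open>s ^ (p - 2) * ?t * sjp_C\<close> in two ways gives
    \<open>s ^ p * ginv\<close>, congruent to \<beta> times \<open>ginv\<close>, and \<alpha> times
    \<open>s ^ (p - 2) * ?t\<close>.\<close>
  let ?r = "sjp_scalar (inverse \<beta> * \<alpha>) * (sjp_s ^ (?p - 2) * ?t)"
  have sp: "sjp_s ^ (?p - 2) * (?t * ?t) = sjp_s ^ ?p"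
  proof -
    have "?p - 2 + 2 = ?p" using p by simp
    then show ?thesis by (metis power_add sjp.t_square)
  qed
  have "sjp_s ^ (?p - 2) * ?t * sjp_C = sjp_s ^ (?p - 2) * (?t * ?t) * sjp_ginv"
    by (simp only: sjp_C_def mult.assoc)
  then have "sjp_s ^ (?p - 2) * ?t * (sjp_C - sjp_scalar \<alpha>) = sjp_s ^ (?p - 2) * (?t * ?t) * sjp_ginv
      - sjp_scalar \<alpha> * (sjp_s ^ (?p - 2) * ?t)"
    by (simp only: right_diff_distrib[of _ sjp_C] sjp_scalar_commute[of \<alpha>])
  then have "sjp_s ^ ?p * sjp_ginv - sjp_scalar \<alpha> * (sjp_s ^ (?p - 2) * ?t) \<in> J"
    using J_gens(1) J_ideal(4) sp by metis
  moreover have "(sjp_s ^ ?p - sjp_scalar \<beta>) * sjp_ginv \<in> J" using J_gens(2) J_ideal(5) by blast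
  ultimately have "sjp_s ^ ?p * sjp_ginv - sjp_scalar \<alpha> * (sjp_s ^ (?p - 2) * ?t)
      - (sjp_s ^ ?p - sjp_scalar \<beta>) * sjp_ginv \<in> J" by (rule J_ideal(6))
  moreover have "sjp_scalar \<beta> * ?r = sjp_scalar \<alpha> * (sjp_s ^ (?p - 2) * ?t)"
    using \<beta> by (simp add: flip: mult.assoc sjp_scalar_simps(4))
  ultimately have "sjp_scalar \<beta> * (sjp_ginv - ?r) \<in> J"
    by (simp only: right_diff_distrib[of "sjp_scalar \<beta>"] left_diff_distrib[of _ _ sjp_ginv]) simp
  then have "sjp_ginv - ?r \<in> J" using J_scalar_cancel \<beta> by metis
  then show ?case
    by (rule xy_span_cong_left_mult[OF _ _ ginv])
      (simp only: mult.assoc xy_span_mult_scalar xy_span_mult_s_power xy_span_mult_t[unfolded mult.assoc])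
qed

lemma J_sum: "(\<And>b. b \<in> A \<Longrightarrow> f b \<in> J) \<Longrightarrow> sum f A \<in> J"
  by (induction A rule: infinite_finite_induct) (simp_all add: J_ideal)

text \<open>In the normal form \<open>e\<close> is 1 or \<open>x\<close>, standing between the
  coefficients in \<open>s\<close> and the powers of \<open>y\<close>.\<close>

definition y_poly :: "(nat \<Rightarrow> 'k sjp) \<Rightarrow> 'k sjp \<Rightarrow> 'k sjp" where
  "y_poly q e = (\<Sum>n<2 * CHAR('k). q n * (e * sjp_y ^ n))"

lemma y_poly_add: "y_poly q e + y_poly r e = y_poly (\<lambda>n. q n + r n) e"
  by (simp add: y_poly_def sum.distrib distrib_right)

lemma y_poly_if: "n < 2 * CHAR('k) \<Longrightarrow> y_poly (\<lambda>i. if i = n then q else 0) e = q * (e * sjp_y ^ n)"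
  by (simp add: y_poly_def if_distrib[of "\<lambda>a. a * _"] cong: if_cong)

lemma y_poly_0: "y_poly (\<lambda>_. 0) e = 0"
  by (simp add: y_poly_def)

lemma y_power_mod_J:
  "sjp_y ^ n - sjp_scalar ((\<beta>\<^sup>2 * \<gamma> ^ CHAR('k)) ^ (n div (2 * CHAR('k)))) * sjp_y ^ (n mod (2 * CHAR('k))) \<in> J"
proof -
  let ?k = "n div (2 * CHAR('k))" and ?r = "n mod (2 * CHAR('k))"
  have "sjp_y ^ n = ((sjp_y :: 'k sjp) ^ (2 * CHAR('k))) ^ ?k * sjp_y ^ ?r"
    by (simp flip: power_mult power_add)
  then show ?thesis
    using J_ideal(5)[OF J_power[OF J_gens(3), of ?k], of "sjp_y ^ ?r"]
    by (simp only: left_diff_distrib)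
qed

lemma s_power_mod_J:
  "sjp_s ^ n - sjp_scalar (\<beta> ^ (n div CHAR('k))) * sjp_s ^ (n mod CHAR('k)) \<in> J"
proof -
  let ?k = "n div CHAR('k)" and ?r = "n mod CHAR('k)"
  have "sjp_s ^ n = ((sjp_s :: 'k sjp) ^ CHAR('k)) ^ ?k * sjp_s ^ ?r"
    by (simp flip: power_mult power_add)
  then show ?thesis
    using J_ideal(5)[OF J_power[OF J_gens(2), of ?k], of "sjp_s ^ ?r"]
    by (simp only: left_diff_distrib)
qed

text \<open>The coefficients do not depend on \<open>e\<close>, so one reduction of the exponent of
  \<open>y\<close> serves both \<open>e = 1\<close> and \<open>e = x\<close>.\<close>

lemma monomial_normal_form:
  obtains q where "range q \<subseteq> s_span"
    "\<And>e. sjp_scalar c * sjp_s ^ m * (e * sjp_y ^ n) - y_poly q e \<in> J"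
proof
  let ?p = "2 * CHAR('k)" and ?d = "(\<beta>\<^sup>2 * \<gamma> ^ CHAR('k)) ^ (n div (2 * CHAR('k)))"
  let ?q = "\<lambda>i. if i = n mod ?p then sjp_scalar (c * ?d) * sjp_s ^ m else 0"
  show "range ?q \<subseteq> s_span" by (auto simp: s_span.monomial s_span_0)
  fix e
  have "sjp_scalar (c * ?d) * sjp_s ^ m * (e * sjp_y ^ (n mod ?p))
      = sjp_scalar c * sjp_s ^ m * (e * (sjp_scalar ?d * sjp_y ^ (n mod ?p)))"
    by (simp add: mult.assoc sjp_scalar_simps(4) sjp_scalar_left_commute[of e]
        sjp_scalar_left_commute[of "_ ^ _"])
  moreover have "y_poly ?q e = sjp_scalar (c * ?d) * sjp_s ^ m * (e * sjp_y ^ (n mod ?p))"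
    using p by (intro y_poly_if) simp
  ultimately have "sjp_scalar c * sjp_s ^ m * (e * sjp_y ^ n) - y_poly ?q e
      = sjp_scalar c * sjp_s ^ m * (e * (sjp_y ^ n - sjp_scalar ?d * sjp_y ^ (n mod ?p)))"
    by (simp only: right_diff_distrib)
  then show "sjp_scalar c * sjp_s ^ m * (e * sjp_y ^ n) - y_poly ?q e \<in> J"
    using y_power_mod_J[of n] J_ideal(4) by metis
qed

lemma xy_span_normal_form:
  assumes "a \<in> xy_span"
  shows "\<exists>q r. range q \<subseteq> s_span \<and> range r \<subseteq> s_span \<and> a - (y_poly q 1 + y_poly r sjp_x) \<in> J"
  using assms
proof induction
  case (y_monomial c m n)
  obtain q where "range q \<subseteq> s_span" "\<And>e. sjp_scalar c * sjp_s ^ m * (e * sjp_y ^ n) - y_poly q e \<in> J"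
    by (rule monomial_normal_form[of c m n]) blast
  from this(1) this(2)[of 1] show ?case
    by (intro exI[of _ q] exI[of _ "\<lambda>_. 0"]) (auto simp: y_poly_0 s_span_0)
next
  case (x_monomial c m n)
  obtain q where "range q \<subseteq> s_span" "\<And>e. sjp_scalar c * sjp_s ^ m * (e * sjp_y ^ n) - y_poly q e \<in> J"
    by (rule monomial_normal_form[of c m n]) blast
  from this(1) this(2)[of sjp_x] show ?case
    by (intro exI[of _ "\<lambda>_. 0"] exI[of _ q]) (auto simp: y_poly_0 s_span_0)
next
  case (add a b)
  then obtain q r q' r' where
    "range q \<subseteq> s_span" "range r \<subseteq> s_span" "a - (y_poly q 1 + y_poly r sjp_x) \<in> J"
    "range q' \<subseteq> s_span" "range r' \<subseteq> s_span" "b - (y_poly q' 1 + y_poly r' sjp_x) \<in> J"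
    by blast
  note qr = this
  show ?case
  proof (intro exI conjI)
    show "range (\<lambda>n. q n + q' n) \<subseteq> s_span" "range (\<lambda>n. r n + r' n) \<subseteq> s_span"
      using qr by (auto intro!: s_span.add)
    show "a + b - (y_poly (\<lambda>n. q n + q' n) 1 + y_poly (\<lambda>n. r n + r' n) sjp_x) \<in> J"
      using J_ideal(2)[OF qr(3,6)] by (simp add: algebra_simps flip: y_poly_add)
  qed
qed

lemma s_span_normal_form:
  "q \<in> s_span \<Longrightarrow> \<exists>c. q - (\<Sum>i<CHAR('k). sjp_scalar (c i) * sjp_s ^ i) \<in> J"
proof (induction rule: s_span.induct)
  case (monomial c n)
  let ?d = "\<beta> ^ (n div CHAR('k))" and ?r = "n mod CHAR('k)"
  have "sjp_scalar c * (sjp_s ^ n - sjp_scalar ?d * sjp_s ^ ?r) \<in> J"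
    using s_power_mod_J J_ideal(4) by blast
  moreover have "(\<Sum>i<CHAR('k). sjp_scalar (if i = ?r then c * ?d else 0) * sjp_s ^ i)
      = sjp_scalar (c * ?d) * sjp_s ^ ?r"
    using p by (simp add: if_distrib[of sjp_scalar] if_distrib[of "\<lambda>a. a * _"] sjp_scalar_simps(1) cong: if_cong)
  ultimately show ?case
    by (intro exI[of _ "\<lambda>i. if i = ?r then c * ?d else 0"])
      (simp only: right_diff_distrib sjp_scalar_simps mult.assoc)
next
  case (add a b)
  then obtain c d where "a - (\<Sum>i<CHAR('k). sjp_scalar (c i) * sjp_s ^ i) \<in> J"
    "b - (\<Sum>i<CHAR('k). sjp_scalar (d i) * sjp_s ^ i) \<in> J" by blast
  from J_ideal(2)[OF this] show ?case
    by (intro exI[of _ "\<lambda>i. c i + d i"])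
      (simp add: sjp_scalar_simps distrib_right sum.distrib add_diff_add)
qed

section \<open>Normal forms that annihilate V\<close>

abbreviation ann :: "'k sjp set" where "ann \<equiv> annihilator V_carrier act"

lemmas ann_ideal = two_sided_idealD[OF two_sided_ideal_annihilator]

lemmas ann_scalar_cancel = two_sided_ideal_scalar_cancel[OF two_sided_ideal_annihilator]

lemma ann_cong: "a - b \<in> J \<Longrightarrow> a \<in> ann \<longleftrightarrow> b \<in> ann"
  using J_subset_annihilator ann_ideal(6)[of a "a - b"] ann_ideal(2)[of "a - b" b] by auto

text \<open>Once \<open>q\<close> is reduced to degree below p, \<open>q * x\<close> sends
  \<open>ww 0\<close> to a combination of independent \<open>vv i\<close> with the coefficients of
  \<open>q\<close>.\<close>

lemma s_span_mult_x_ann: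
  assumes q: "q \<in> s_span" and ann: "q * sjp_x \<in> ann"
  shows "q \<in> J"
proof -
  obtain c where c: "q - (\<Sum>i<CHAR('k). sjp_scalar (c i) * sjp_s ^ i) \<in> J"
    using s_span_normal_form[OF q] by blast
  let ?q = "\<Sum>i<CHAR('k). sjp_scalar (c i) * sjp_s ^ i"
  have "(q - ?q) * sjp_x \<in> J" using c J_ideal(5) by blast
  then have "q * sjp_x - ?q * sjp_x \<in> J" by (simp only: left_diff_distrib)
  then have "?q * sjp_x \<in> ann" using ann ann_cong by blast
  then have "act (?q * sjp_x) (ww 0) = 0" using ww_mem unfolding annihilator_def by blast
  moreover have "act (\<Sum>i\<in>A. sjp_scalar (c i) * sjp_s ^ i) (vv 0) = (\<Sum>i\<in>A. vscale (c i) (vv i))" for A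
    by (induction A rule: infinite_finite_induct)
      (simp_all add: act_zero_left act_add_left act_mult act_scalar act_s_power)
  ultimately have 0: "(\<Sum>i<CHAR('k). vscale (c i) (vv i)) = 0" by (simp add: act_mult act_x)
  have "c i = 0" if "i < CHAR('k)" for i
    using lookup_sum_vv[OF that, of c] unfolding 0 by simp
  then have "?q = 0" by (simp add: sjp_scalar_simps)
  with c show ?thesis by simp
qed

text \<open>\<open>s\<close> can be cancelled, since \<open>s ^ p\<close> is congruent to the
  nonzero scalar \<beta>.\<close>

lemma s_span_mult_s_x_ann:
  assumes q: "q \<in> s_span" and ann: "q * sjp_s * sjp_x \<in> ann"
  shows "q \<in> J"
proof -
  have "q * sjp_s \<in> J" by (rule s_span_mult_x_ann) (use assms in \<open>simp_all add: s_span_mult_s\<close>)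
  then have "q * sjp_s * sjp_s ^ (CHAR('k) - 1) \<in> J" by (rule J_ideal)
  also have "q * sjp_s * sjp_s ^ (CHAR('k) - 1) = q * sjp_s ^ CHAR('k)"
    using p power_minus_mult[of "CHAR('k)" "sjp_s :: 'k sjp"]
    by (simp add: mult.assoc power_commutes)
  finally have "q * sjp_s ^ CHAR('k) - q * (sjp_s ^ CHAR('k) - sjp_scalar \<beta>) \<in> J"
    using J_ideal(6)[OF _ J_ideal(4)[OF J_gens(2)]] by blast
  then have "sjp_scalar \<beta> * q \<in> J" by (simp add: right_diff_distrib sjp_scalar_commute)
  then show ?thesis using \<beta> J_scalar_cancel by blast
qed

text \<open>Up to the scalar \<open>- \<beta>\<close>, commutation with \<open>s\<^sup>p\<^sup>-\<^sup>1\<close> differentiates with respect to \<open>y\<^sup>2\<close>.\<close>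

lemma y2_coeffs_ann:
  assumes "(\<Sum>b<n. c b * ((sjp_y\<^sup>2) ^ b * e)) \<in> ann" "n \<le> CHAR('k)"
    and "\<And>b. b < n \<Longrightarrow> c b * sjp_s ^ (CHAR('k) - 1) = sjp_s ^ (CHAR('k) - 1) * c b"
    and e: "e * sjp_s ^ (CHAR('k) - 1) = sjp_s ^ (CHAR('k) - 1) * e"
      "\<And>b. \<exists>r. (sjp_y\<^sup>2) ^ b * e = e * r"
    and "b < n"
  shows "c b * e \<in> ann"
  using assms(1,2,3,6)
proof (induction n arbitrary: c b)
  case (Suc n)
  let ?p = "CHAR('k)" and ?u = "sjp_s ^ (CHAR('k) - 1) :: 'k sjp"
  let ?Y = "\<lambda>b. (sjp_y\<^sup>2) ^ b :: 'k sjp"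
  define a where "a = (\<Sum>b<Suc n. c b * (?Y b * e))"
  \<comment> \<open>Both \<open>c b\<close> and \<open>e\<close> commute with \<open>?u\<close>, so
    only the power of \<open>y\<^sup>2\<close> contributes to the commutator.\<close>
  have u: "c b * (?Y b * e) * ?u - ?u * (c b * (?Y b * e))
      = - (c b * (of_nat b * sjp_s ^ ?p * (?Y (b - 1) * e)))" if "b < Suc n" for b
  proof -
    have "c b * (?Y b * e) * ?u = c b * (?Y b * ?u) * e"
      by (simp only: mult.assoc e)
    also have "\<dots> = c b * ?u * (?Y b * e) - c b * (of_nat b * sjp_s ^ ?p * (?Y (b - 1) * e))"
      using p sjp.y2_power_s_power_pred[of ?p b, where 'k = 'k]
      by (simp add: of_nat_CHAR_sjp right_diff_distrib left_diff_distrib mult.assoc)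
    also have "c b * ?u = ?u * c b" by (rule Suc.prems(3)[OF that])
    finally show ?thesis by (simp add: mult.assoc)
  qed
  have a: "a \<in> ann" using Suc.prems(1) by (simp only: a_def)
  have "a * ?u - ?u * a \<in> ann" by (intro ann_ideal(4-6) a)
  also have "a * ?u - ?u * a = (\<Sum>b<Suc n. - (c b * (of_nat b * sjp_s ^ ?p * (?Y (b - 1) * e))))"
    unfolding a_def sum_distrib_left sum_distrib_right sum_subtractf[symmetric]
    by (rule sum.cong) (use u in auto)
  also have "\<dots> = - (\<Sum>b<Suc n. c b * (of_nat b * sjp_s ^ ?p * (?Y (b - 1) * e)))"
    by (rule sum_negf)
  finally have "(\<Sum>b<Suc n. c b * (of_nat b * sjp_s ^ ?p * (?Y (b - 1) * e))) \<in> ann"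
    by (subst minus_minus[symmetric]) (rule ann_ideal(3))
  moreover have "(\<Sum>b<Suc n. c b * (of_nat b * sjp_s ^ ?p * (?Y (b - 1) * e)))
      - sjp_scalar \<beta> * (\<Sum>b<Suc n. c b * (of_nat b * (?Y (b - 1) * e))) \<in> J"
  proof -
    have "(\<Sum>b<Suc n. c b * of_nat b * (sjp_s ^ ?p - sjp_scalar \<beta>) * (?Y (b - 1) * e)) \<in> J"
      by (intro J_sum J_ideal J_gens)
    moreover have "c b * of_nat b * (sjp_s ^ ?p - sjp_scalar \<beta>) * (?Y (b - 1) * e)
        = c b * (of_nat b * sjp_s ^ ?p * (?Y (b - 1) * e)) - sjp_scalar \<beta> * (c b * (of_nat b * (?Y (b - 1) * e)))" for b
      by (simp add: right_diff_distrib left_diff_distrib mult.assoc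
          sjp_scalar_left_commute[of "c b"] sjp_scalar_left_commute[of "of_nat b"])
    ultimately show ?thesis by (simp only: sum_subtractf sum_distrib_left)
  qed
  ultimately have "sjp_scalar \<beta> * (\<Sum>b<Suc n. c b * (of_nat b * (?Y (b - 1) * e))) \<in> ann"
    using ann_cong by blast
  then have "(\<Sum>b<Suc n. c b * (of_nat b * (?Y (b - 1) * e))) \<in> ann"
    by (rule ann_scalar_cancel[OF \<beta>])
  \<comment> \<open>The constant term has been differentiated away, leaving \<open>n\<close> terms
    for the induction hypothesis.\<close>
  also have "(\<Sum>b<Suc n. c b * (of_nat b * (?Y (b - 1) * e)))
      = (\<Sum>b<n. of_nat (Suc b) * c (Suc b) * (?Y b * e))"
    by (subst sum.lessThan_Suc_shift) (simp add: mult_of_nat_commute mult.assoc del: of_nat_Suc)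
  finally have d: "(\<Sum>b<n. of_nat (Suc b) * c (Suc b) * (?Y b * e)) \<in> ann" .
  have hi: "c (Suc b) * e \<in> ann" if "b < n" for b
  proof -
    have "of_nat (Suc b) * c (Suc b) * e \<in> ann"
    proof (rule Suc.IH[OF d])
      fix b assume "b < n"
      then have "c (Suc b) * ?u = ?u * c (Suc b)" by (intro Suc.prems(3)) simp
      then show "of_nat (Suc b) * c (Suc b) * ?u = ?u * (of_nat (Suc b) * c (Suc b))"
        by (simp only: mult.assoc) (simp only: mult_of_nat_commute[of "Suc b" ?u] flip: mult.assoc)
    qed (use Suc.prems that in auto)
    then have "sjp_scalar (of_nat (Suc b)) * (c (Suc b) * e) \<in> ann"
      by (simp only: sjp_scalar_of_nat mult.assoc)
    moreover have "(of_nat (Suc b) :: 'k) \<noteq> 0"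
      using that Suc.prems(2) unfolding of_nat_eq_0_iff_char_dvd by (auto dest: dvd_imp_le)
    ultimately show ?thesis using ann_scalar_cancel by blast
  qed
  \<comment> \<open>Pulling \<open>e\<close> to the left turns each higher term into a right
    multiple of \<open>c (Suc b) * e\<close>; subtracting these isolates
    \<open>c 0 * e\<close>.\<close>
  have "c (Suc b) * (?Y (Suc b) * e) \<in> ann" if "b < n" for b
  proof -
    obtain r where "?Y (Suc b) * e = e * r" using e(2) by blast
    then have "c (Suc b) * (?Y (Suc b) * e) = c (Suc b) * e * r" by (simp only: mult.assoc)
    then show ?thesis using ann_ideal(5)[OF hi[OF that]] by simp
  qed
  then have "(\<Sum>b<n. c (Suc b) * (?Y (Suc b) * e)) \<in> ann"
    by (induction n) (simp_all add: ann_ideal)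
  then have "a - (\<Sum>b<n. c (Suc b) * (?Y (Suc b) * e)) \<in> ann"
    by (rule ann_ideal(6)[OF a])
  then have "c 0 * e \<in> ann" unfolding a_def by (subst (asm) sum.lessThan_Suc_shift) simp
  then show ?case using hi Suc.prems(4) by (cases b) auto
qed simp

definition y2_poly :: "(nat \<Rightarrow> 'k sjp) \<Rightarrow> 'k sjp \<Rightarrow> 'k sjp" where
  "y2_poly q e = (\<Sum>b<CHAR('k). q b * (e * (sjp_y\<^sup>2) ^ b))"

text \<open>Even and odd exponents of \<open>y\<close> are separated; for odd ones a factor
  \<open>y\<close> joins \<open>e\<close>.\<close>

lemma y_poly_split:
  "y_poly q e = y2_poly (\<lambda>b. q (2 * b)) e + y2_poly (\<lambda>b. q (2 * b + 1)) (e * sjp_y)"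
proof -
  have "(\<Sum>n<2 * m. f n) = (\<Sum>b<m. f (2 * b)) + (\<Sum>b<m. f (2 * b + 1))" for m and f :: "nat \<Rightarrow> 'k sjp"
    by (induction m) (simp_all add: ac_simps)
  then show ?thesis by (simp add: y_poly_def y2_poly_def power_mult mult.assoc)
qed

lemma y2_poly_x: "y2_poly q sjp_x * sjp_x = 0"
  by (simp add: y2_poly_def sum_distrib_right mult.assoc sjp.x_y2_power_x)

lemma y2_poly_x_y_x: "y2_poly q (sjp_x * sjp_y) * sjp_x =
    (\<Sum>b<CHAR('k). q b * sjp_s * ((sjp_y\<^sup>2) ^ b * sjp_x))"
  by (simp add: y2_poly_def sum_distrib_right mult.assoc sjp.x_y_y2_power_x)

lemma y2_poly_J: "(\<And>b. b < CHAR('k) \<Longrightarrow> q b \<in> J) \<Longrightarrow> y2_poly q e \<in> J"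
  unfolding y2_poly_def by (rule J_sum) (simp add: J_ideal)

context
  fixes q :: "nat \<Rightarrow> 'k sjp" assumes q: "range q \<subseteq> s_span"
begin

lemma q_x: "q b * sjp_x = sjp_x * q b"
  using q s_span_commute(1) by blast

lemma x_y2_poly: "sjp_x * y2_poly q e = y2_poly q (sjp_x * e)"
  unfolding y2_poly_def sum_distrib_left by (rule sum.cong) (auto simp: q_x simp flip: mult.assoc)

lemma y2_poly_x_ann_J:
  assumes "y2_poly q sjp_x \<in> ann" "b < CHAR('k)"
  shows "q b \<in> J"
proof -
  \<comment> \<open>Here \<open>x\<close> is absorbed into the coefficients and
    \<open>y2_coeffs_ann\<close> is used with \<open>e = 1\<close>.\<close>
  have "(\<Sum>b<CHAR('k). q b * sjp_x * ((sjp_y\<^sup>2) ^ b * 1)) \<in> ann"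
    using assms(1) by (simp add: y2_poly_def mult.assoc)
  then have "q b * sjp_x * 1 \<in> ann"
  proof (rule y2_coeffs_ann)
    fix b show "q b * sjp_x * sjp_s ^ (CHAR('k) - 1) = sjp_s ^ (CHAR('k) - 1) * (q b * sjp_x)"
      using q s_span_commute(2)[of "q b"] by (metis mult.assoc rangeI sjp.x_s_power subsetD)
  qed (use assms in auto)
  then show ?thesis using s_span_mult_x_ann[of "q b"] q by auto
qed

text \<open>\<open>y2_coeffs_ann\<close> applies with \<open>e = x\<close> and coefficients
  \<open>q b * s\<close>; its condition on \<open>e\<close> is \<open>y2_power_x\<close>.\<close>

lemma y2_poly_x_y_x_ann_J:
  assumes "y2_poly q (sjp_x * sjp_y) * sjp_x \<in> ann" "b < CHAR('k)"
  shows "q b \<in> J"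
proof -
  have "q b * sjp_s * sjp_x \<in> ann"
    using assms(1) unfolding y2_poly_x_y_x
  proof (rule y2_coeffs_ann)
    fix b show "q b * sjp_s * sjp_s ^ (CHAR('k) - 1) = sjp_s ^ (CHAR('k) - 1) * (q b * sjp_s)"
      using q s_span_commute(2)[of "q b"] by (metis mult.assoc rangeI power_commutes subsetD)
  qed (use assms(2) sjp.y2_power_x sjp.x_s_power in auto)
  then show ?thesis using s_span_mult_s_x_ann[of "q b"] q by auto
qed

end

lemma annihilator_subset_J: "ann \<subseteq> J"
proof
  fix a assume a: "a \<in> ann"
  obtain m where m: "m \<in> xy_span" "a - m \<in> J" using xy_span_mod_J by blast
  obtain q r where qr: "range q \<subseteq> s_span" "range r \<subseteq> s_span"
    and nf: "m - (y_poly q 1 + y_poly r sjp_x) \<in> J"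
    using xy_span_normal_form[OF m(1)] by blast
  let ?F = "\<lambda>b. q (2 * b)" and ?H = "\<lambda>b. q (2 * b + 1)"
  let ?G = "\<lambda>b. r (2 * b)" and ?L = "\<lambda>b. r (2 * b + 1)"
  have span: "range ?F \<subseteq> s_span" "range ?G \<subseteq> s_span" "range ?H \<subseteq> s_span" "range ?L \<subseteq> s_span"
    using qr by auto
  \<comment> \<open>The four groups record the parity of the exponent of \<open>y\<close> and the
    presence of \<open>x\<close>.\<close>
  define n where "n = y2_poly ?F 1 + y2_poly ?H sjp_y + y2_poly ?G sjp_x + y2_poly ?L (sjp_x * sjp_y)"
  have an: "a - n \<in> J"
    using J_trans[OF m(2) nf] by (simp add: n_def y_poly_split add.assoc)
  have n: "n \<in> ann" using an a ann_cong by blast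
  have x_n: "sjp_x * n = y2_poly ?F sjp_x + y2_poly ?H (sjp_x * sjp_y)"
    by (simp only: n_def distrib_left span[THEN x_y2_poly] sjp.x_x sjp.x_x_left)
      (simp add: y2_poly_def)
  \<comment> \<open>Left multiplication by \<open>x\<close> removes \<open>?G\<close> and
    \<open>?L\<close>; right multiplication then removes \<open>?F\<close>, leaving
    \<open>?H\<close>.\<close>
  have "sjp_x * n * sjp_x \<in> ann" by (intro ann_ideal(4,5) n)
  then have H: "?H b \<in> J" if "b < CHAR('k)" for b
    using that y2_poly_x_y_x_ann_J[OF span(3), of b] by (simp add: x_n distrib_right y2_poly_x)
  then have HJ: "y2_poly ?H e \<in> J" for e by (intro y2_poly_J)
  then have "sjp_x * n - y2_poly ?F sjp_x \<in> J" by (simp add: x_n)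
  then have "y2_poly ?F sjp_x \<in> ann" using ann_cong ann_ideal(4)[OF n] by blast
  then have FJ: "y2_poly ?F e \<in> J" for e using y2_poly_x_ann_J[OF span(1)] by (intro y2_poly_J)
  define n' where "n' = y2_poly ?G sjp_x + y2_poly ?L (sjp_x * sjp_y)"
  have nn: "n - n' \<in> J" using FJ HJ J_ideal(2) by (simp add: n_def n'_def)
  then have n': "n' \<in> ann" using ann_cong n by blast
  \<comment> \<open>Every term of \<open>n'\<close> already contains \<open>x\<close>, so right
    multiplication by \<open>x\<close> alone removes \<open>?G\<close> and isolates
    \<open>?L\<close>.\<close>
  then have "n' * sjp_x \<in> ann" by (rule ann_ideal(5))
  then have "?L b \<in> J" if "b < CHAR('k)" for b
    using that y2_poly_x_y_x_ann_J[OF span(4), of b] by (simp add: n'_def distrib_right y2_poly_x)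
  then have LJ: "y2_poly ?L e \<in> J" for e by (intro y2_poly_J)
  then have "y2_poly ?G sjp_x \<in> ann"
    using n' ann_cong[of n' "y2_poly ?G sjp_x"] by (simp add: n'_def)
  then have "y2_poly ?G e \<in> J" for e using y2_poly_x_ann_J[OF span(2)] by (intro y2_poly_J)
  then have "n' \<in> J" using LJ J_ideal(2) by (simp add: n'_def)
  then show "a \<in> J" using J_trans[OF an nn[unfolded n_def[symmetric]]] J_ideal(2)[of "a - n'" n'] by simp
qed

end

theorem proposition4p4:
  fixes \<alpha> \<beta> \<gamma> :: "'k::alg_closed_field" and p :: nat
  assumes "CHAR('k) = p" and "p > 2"
    and "\<alpha> \<noteq> 0" and "\<beta> \<noteq> 0"
  shows "simple_module V_carrier (V_act \<alpha> \<beta> \<gamma>) \<and>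
    annihilator V_carrier (V_act \<alpha> \<beta> \<gamma>) =
      ideal_gen {sjp_C - sjp_scalar \<alpha>,
                 sjp_s ^ p - sjp_scalar \<beta>,
                 sjp_y ^ (2 * p) - sjp_scalar (\<beta>\<^sup>2 * \<gamma> ^ p)} \<and>
    (\<forall>\<alpha>' \<beta>' \<gamma>'. \<alpha>' \<noteq> 0 \<longrightarrow> \<beta>' \<noteq> 0 \<longrightarrow>
      (module_isomorphic V_carrier (V_act \<alpha> \<beta> \<gamma>) V_carrier (V_act \<alpha>' \<beta>' \<gamma>') \<longleftrightarrow>
        \<alpha>' = \<alpha> \<and> \<beta>' = \<beta> \<and> \<gamma>' ^ p = \<gamma> ^ p))"
proof -
  interpret sjp_V \<alpha> \<beta> \<gamma> using assms by unfold_locales auto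
  have "annihilator V_carrier (V_act \<alpha> \<beta> \<gamma>) = J"
    using J_subset_annihilator annihilator_subset_J by blast
  then show ?thesis
    using simple_V assms by (auto simp: J_def V_isomorphic_iff)
qed

end
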